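(* Let $c\ge1$ and let $G$ be a finite nilpotent group of class $t\ge2$, with upper central series terms $Z_j=Z_j(G)$. Then (i)(a) if $c+1\le t$, then $|\gamma_t(G)|\,|M^{(c)}(G)|$ divides $|M^{(c)}(G/\gamma_t(G))|\,|\otimes^{c+1}(\gamma_t(G),G/Z_{t-1}(G))|$; (i)(b) if $c+1>t$, then $|\gamma_{c+1}(G)|\,|M^{(c)}(G)|$ divides $|M^{(c)}(G/\gamma_t(G))|\,|\otimes^{c+1}(\gamma_t(G),G/Z_{t-1}(G))|$; (ii) $\exp(M^{(c)}(G))$ divides $\exp(M^{(c)}(G/\gamma_t(G)))\exp(\otimes^{c+1}(\gamma_t(G),G/Z_{t-1}(G)))$; (iii) $d(M^{(c)}(G))\le d(M^{(c)}(G/\gamma_t(G)))+d(\otimes^{c+1}(\gamma_t(G),G/Z_{t-1}(G)))$.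
   Context: $\gamma_1(X)=X$, $\gamma_{i+1}(X)=[\gamma_i(X),X]$; $Z_j(G)$ is the $j$-th term of the upper central series. For subgroups $U,V$, $[U,{}_0V]=U$, $[U,{}_{i+1}V]=[[U,{}_iV],V]$. The $c$-nilpotent multiplier of $G\cong F/R$ ($F$ free) is $M^{(c)}(G)=(R\cap\gamma_{c+1}(F))/[R,{}_cF]$, independent of the presentation. For groups $B,A$, $\otimes^{c+1}(B,A)$ denotes the tensor product over $\mathbb Z$ $B_{ab}\otimes A_{ab}\otimes\cdots\otimes A_{ab}$ with $c$ copies of $A_{ab}$, where $X_{ab}=X/X'$ (here $\gamma_t(G)$ and $G/Z_{t-1}(G)$ are already abelian). $d(X)$ is the minimal number of generators and $\exp(X)$ the exponent. *)

theory Defs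
  imports "HOL-Algebra.Algebra"
begin

definition gcomm :: "('a, 'm) monoid_scheme \<Rightarrow> 'a \<Rightarrow> 'a \<Rightarrow> 'a" where
  "gcomm G x y = inv\<^bsub>G\<^esub> x \<otimes>\<^bsub>G\<^esub> inv\<^bsub>G\<^esub> y \<otimes>\<^bsub>G\<^esub> x \<otimes>\<^bsub>G\<^esub> y"

definition comm_subgroup :: "('a, 'm) monoid_scheme \<Rightarrow> 'a set \<Rightarrow> 'a set \<Rightarrow> 'a set" where
  "comm_subgroup G U V = generate G {gcomm G u v | u v. u \<in> U \<and> v \<in> V}"

primrec iter_comm :: "('a, 'm) monoid_scheme \<Rightarrow> 'a set \<Rightarrow> 'a set \<Rightarrow> nat \<Rightarrow> 'a set" where
  "iter_comm G U V 0 = U"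
| "iter_comm G U V (Suc i) = comm_subgroup G (iter_comm G U V i) V"

text \<open>Lower central series: lcs G Q i = gamma_i(Q) for i >= 1
  (gamma_1(Q) = Q, gamma_(i+1)(Q) = [gamma_i(Q), Q]).\<close>
definition lcs :: "('a, 'm) monoid_scheme \<Rightarrow> 'a set \<Rightarrow> nat \<Rightarrow> 'a set" where
  "lcs G S k = iter_comm G S S (k - 1)"

primrec upper_central :: "('a, 'm) monoid_scheme \<Rightarrow> nat \<Rightarrow> 'a set" where
  "upper_central G 0 = {\<one>\<^bsub>G\<^esub>}"
| "upper_central G (Suc j) =
     {g \<in> carrier G. \<forall>x \<in> carrier G. gcomm G g x \<in> upper_central G j}"

definition nilpotent_class :: "('a, 'm) monoid_scheme \<Rightarrow> nat \<Rightarrow> bool" where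
  "nilpotent_class G t \<longleftrightarrow>
     lcs G (carrier G) (t + 1) = {\<one>\<^bsub>G\<^esub>} \<and> lcs G (carrier G) t \<noteq> {\<one>\<^bsub>G\<^esub>}"

text \<open>A letter (x, True) stands for x, (x, False) for x^-1.\<close>
fun reduce :: "('a \<times> bool) list \<Rightarrow> ('a \<times> bool) list" where
  "reduce [] = []"
| "reduce (x # xs) =
     (case reduce xs of
        [] \<Rightarrow> [x]
      | y # ys \<Rightarrow> (if fst x = fst y \<and> snd x \<noteq> snd y then ys else x # y # ys))"

definition free_group :: "'a set \<Rightarrow> ('a \<times> bool) list monoid" where
  "free_group Q = \<lparr>carrier = {w. set w \<subseteq> Q \<times> UNIV \<and> reduce w = w},
                   monoid.mult = (\<lambda>u v. reduce (u @ v)), one = []\<rparr>"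

definition free_presentation :: "'x set \<Rightarrow> (('x \<times> bool) list \<Rightarrow> 'a) \<Rightarrow> ('a, 'm) monoid_scheme \<Rightarrow> bool" where
  "free_presentation Q \<pi> G \<longleftrightarrow>
     \<pi> \<in> hom (free_group Q) G \<and> \<pi> ` carrier (free_group Q) = carrier G"

definition c_multiplier ::
  "nat \<Rightarrow> 'x set \<Rightarrow> (('x \<times> bool) list \<Rightarrow> 'a) \<Rightarrow> ('a, 'm) monoid_scheme \<Rightarrow> ('x \<times> bool) list set monoid" where
  "c_multiplier c Q \<pi> G =
     (let F = free_group Q; R = kernel F G \<pi>
      in (F\<lparr>carrier := R \<inter> lcs F (carrier F) (c + 1)\<rparr>) Mod (iter_comm F R (carrier F) c))"

text \<open>tensor_power c B A = B_ab \<otimes> A_ab \<otimes> ... \<otimes> A_ab (c copies of A_ab):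
  free abelian group on B \<times> A^c modulo the multilinearity relations.
  (Multilinearity forces factoring through abelianizations.)\<close>
definition tensor_gens :: "('b, 'm) monoid_scheme \<Rightarrow> ('c, 'n) monoid_scheme \<Rightarrow> nat \<Rightarrow> ('b \<times> 'c list) set" where
  "tensor_gens B A c = carrier B \<times> {as. length as = c \<and> set as \<subseteq> carrier A}"

definition tensor_rels :: "('b, 'm) monoid_scheme \<Rightarrow> ('c, 'n) monoid_scheme \<Rightarrow> nat \<Rightarrow> ('b \<times> 'c list \<Rightarrow>\<^sub>0 int) set" where
  "tensor_rels B A c =
     {Poly_Mapping.single (b1 \<otimes>\<^bsub>B\<^esub> b2, as) 1 - Poly_Mapping.single (b1, as) 1 - Poly_Mapping.single (b2, as) 1
        | b1 b2 as. b1 \<in> carrier B \<and> b2 \<in> carrier B \<and> length as = c \<and> set as \<subseteq> carrier A}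
   \<union> {Poly_Mapping.single (b, as[i := a1 \<otimes>\<^bsub>A\<^esub> a2]) 1 - Poly_Mapping.single (b, as[i := a1]) 1
          - Poly_Mapping.single (b, as[i := a2]) 1
        | b as i a1 a2. b \<in> carrier B \<and> length as = c \<and> set as \<subseteq> carrier A \<and> i < c
                        \<and> a1 \<in> carrier A \<and> a2 \<in> carrier A}"

definition tensor_power :: "nat \<Rightarrow> ('b, 'm) monoid_scheme \<Rightarrow> ('c, 'n) monoid_scheme \<Rightarrow> ('b \<times> 'c list \<Rightarrow>\<^sub>0 int) set monoid" where
  "tensor_power c B A =
     (let FA = free_Abelian_group (tensor_gens B A c)
      in FA Mod (generate FA (tensor_rels B A c)))"

definition group_exponent :: "('a, 'm) monoid_scheme \<Rightarrow> nat" where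
  "group_exponent G = Lcm (group.ord G ` carrier G)"

definition min_gens :: "('a, 'm) monoid_scheme \<Rightarrow> nat" where
  "min_gens G = (LEAST n. \<exists>S. finite S \<and> card S = n \<and> S \<subseteq> carrier G \<and> generate G S = carrier G)"

end

theory Submission
  imports Defs
begin

text \<open>
  Write \<open>G = F/R\<close> with \<open>F\<close> free and let \<open>S\<close> be the preimage of \<open>\<gamma>\<^sub>t(G)\<close>, so that
  \<open>G/\<gamma>\<^sub>t(G) = F/S\<close> and \<open>S = \<gamma>\<^sub>t(F) R\<close>. The natural map \<open>M\<^sup>c(G) \<rightarrow> M\<^sup>c(G/\<gamma>\<^sub>t(G))\<close> has kernel
  \<open>[S,\<^sub>cF]/[R,\<^sub>cF]\<close>, and its cokernel is isomorphic to \<open>\<gamma>\<^sub>t(G) \<inter> \<gamma>\<^sub>c\<^sub>+\<^sub>1(G)\<close>. Every element of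
  \<open>[S,\<^sub>cF]\<close> is congruent modulo \<open>[R,\<^sub>cF]\<close> to one of \<open>\<gamma>\<^sub>t\<^sub>+\<^sub>c(F)\<close>, and since \<open>\<gamma>\<^sub>t\<^sub>+\<^sub>1(F) \<subseteq> R\<close>, left-normed
  commutators \<open>[s, f\<^sub>1, \<dots>, f\<^sub>c]\<close> with \<open>s \<in> \<gamma>\<^sub>t(F)\<close> are multilinear modulo \<open>[R,\<^sub>cF]\<close>. If \<open>w\<close> lies over
  \<open>Z\<^sub>t\<^sub>-\<^sub>1(G)\<close>, the three subgroup lemma gives \<open>[\<gamma>\<^sub>t\<^sub>+\<^sub>i(F), w] \<subseteq> [R,\<^sub>i\<^sub>+\<^sub>1F]\<close>, so the commutator depends on
  the \<open>f\<^sub>j\<close> only modulo the preimage of \<open>Z\<^sub>t\<^sub>-\<^sub>1(G)\<close>. Hence the tensor power maps onto the kernel,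
  which yields all the bounds.

  As \<^const>\<open>min_gens\<close> is a \<open>LEAST\<close> and unspecified for groups that are not finitely generated, the
  bound on generators also needs that the multiplier of a finite nilpotent group is finitely
  generated; this follows by applying the same exact sequence down the lower central series.
\<close>

section \<open>Commutators and iterated commutator subgroups\<close>

context group
begin

lemma inv_mult_cancel [simp]:
  assumes "x \<in> carrier G" "y \<in> carrier G"
  shows "inv x \<otimes> (x \<otimes> y) = y" "x \<otimes> (inv x \<otimes> y) = y"
  using assms by (simp_all flip: m_assoc)

lemma gcomm_closed [simp]:
  "x \<in> carrier G \<Longrightarrow> y \<in> carrier G \<Longrightarrow> gcomm G x y \<in> carrier G"
  by (simp add: gcomm_def)

lemma gcomm_mult_left:
  assumes "x \<in> carrier G" "y \<in> carrier G" "z \<in> carrier G"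
  shows "gcomm G (x \<otimes> y) z = inv y \<otimes> gcomm G x z \<otimes> y \<otimes> gcomm G y z"
  using assms by (simp add: gcomm_def m_assoc inv_mult_group)

lemma gcomm_mult_right:
  assumes "x \<in> carrier G" "y \<in> carrier G" "z \<in> carrier G"
  shows "gcomm G x (y \<otimes> z) = gcomm G x z \<otimes> (inv z \<otimes> gcomm G x y \<otimes> z)"
  using assms by (simp add: gcomm_def m_assoc inv_mult_group)

lemma gcomm_inv:
  assumes "x \<in> carrier G" "y \<in> carrier G"
  shows "inv (gcomm G x y) = gcomm G y x"
  using assms by (simp add: gcomm_def m_assoc inv_mult_group)

lemma gcomm_inv_left:
  assumes "x \<in> carrier G" "y \<in> carrier G"
  shows "gcomm G (inv x) y = x \<otimes> inv (gcomm G x y) \<otimes> inv x"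
  using assms by (simp add: gcomm_def m_assoc inv_mult_group)

lemma gcomm_one [simp]:
  "x \<in> carrier G \<Longrightarrow> gcomm G \<one> x = \<one>" "x \<in> carrier G \<Longrightarrow> gcomm G x \<one> = \<one>"
  by (simp_all add: gcomm_def)

text \<open>The Hall-Witt identity: after expansion the word cancels freely, so plain simplification
  proves it. It is the source of \<open>gcomm_iter_comm\<close>.\<close>

lemma hall_witt:
  assumes "x \<in> carrier G" "y \<in> carrier G" "z \<in> carrier G"
  shows "(inv y \<otimes> gcomm G (gcomm G x (inv y)) z \<otimes> y)
       \<otimes> (inv z \<otimes> gcomm G (gcomm G y (inv z)) x \<otimes> z)
       \<otimes> (inv x \<otimes> gcomm G (gcomm G z (inv x)) y \<otimes> x) = \<one>"
  using assms by (simp add: gcomm_def m_assoc inv_mult_group)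

lemma normal_conj:
  assumes "N \<lhd> G" "n \<in> N" "g \<in> carrier G"
  shows "inv g \<otimes> n \<otimes> g \<in> N" "g \<otimes> n \<otimes> inv g \<in> N"
  using normal.inv_op_closed1[OF assms(1,3,2)] normal.inv_op_closed2[OF assms(1,3,2)] .

lemma normal_mem_carrier:
  "N \<lhd> G \<Longrightarrow> n \<in> N \<Longrightarrow> n \<in> carrier G"
  by (meson normal_imp_subgroup subgroup.mem_carrier)

lemma gcomm_mem_normal:
  assumes "N \<lhd> G" "g \<in> carrier G" "n \<in> N"
  shows "gcomm G n g \<in> N" "gcomm G g n \<in> N"
proof -
  interpret N: normal N G by fact
  have n: "n \<in> carrier G" using assms by simp
  have "gcomm G n g = inv n \<otimes> (inv g \<otimes> n \<otimes> g)"
    using n assms by (simp add: gcomm_def m_assoc)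
  then show "gcomm G n g \<in> N"
    using assms normal_conj by simp
  then have "inv (gcomm G n g) \<in> N" by simp
  then show "gcomm G g n \<in> N" using n assms by (simp add: gcomm_inv)
qed

lemma comm_subgroup_gen_subset:
  "U \<subseteq> carrier G \<Longrightarrow> V \<subseteq> carrier G \<Longrightarrow> {gcomm G u v | u v. u \<in> U \<and> v \<in> V} \<subseteq> carrier G"
  by (auto intro!: gcomm_closed)

lemma gcomm_in_comm_subgroup:
  "u \<in> U \<Longrightarrow> v \<in> V \<Longrightarrow> gcomm G u v \<in> comm_subgroup G U V"
  unfolding comm_subgroup_def by (rule generate.incl) auto

lemma comm_subgroup_least:
  assumes "subgroup H G" "\<And>u v. u \<in> U \<Longrightarrow> v \<in> V \<Longrightarrow> gcomm G u v \<in> H"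
  shows "comm_subgroup G U V \<subseteq> H"
  unfolding comm_subgroup_def using assms by (intro generate_subgroup_incl) auto

text \<open>Conjugating a commutator conjugates both entries, so normality of \<open>U\<close> and
  \<open>V\<close> makes the generating set itself stable under conjugation.\<close>

lemma comm_subgroup_normal:
  assumes "U \<lhd> G" "V \<lhd> G"
  shows "comm_subgroup G U V \<lhd> G"
  unfolding comm_subgroup_def
proof (rule normal_generateI)
  show "{gcomm G u v |u v. u \<in> U \<and> v \<in> V} \<subseteq> carrier G"
    using assms normal_mem_carrier by auto
  fix h g assume "h \<in> {gcomm G u v |u v. u \<in> U \<and> v \<in> V}" and g: "g \<in> carrier G"
  then obtain u v where h: "h = gcomm G u v" "u \<in> U" "v \<in> V" by blast
  have uv: "u \<in> carrier G" "v \<in> carrier G" using h assms normal_mem_carrier by auto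
  have "g \<otimes> h \<otimes> inv g = gcomm G (g \<otimes> u \<otimes> inv g) (g \<otimes> v \<otimes> inv g)"
    using uv g by (simp add: h gcomm_def m_assoc inv_mult_group)
  moreover have "g \<otimes> u \<otimes> inv g \<in> U" "g \<otimes> v \<otimes> inv g \<in> V"
    using assms h g normal_conj by auto
  ultimately show "g \<otimes> h \<otimes> inv g \<in> {gcomm G u v |u v. u \<in> U \<and> v \<in> V}" by blast
qed

lemma normal_carrier: "carrier G \<lhd> G"
  by (simp add: normal_inv_iff subgroup_self)

lemma iter_comm_normal:
  "U \<lhd> G \<Longrightarrow> V \<lhd> G \<Longrightarrow> iter_comm G U V i \<lhd> G"
  by (induction i) (auto intro: comm_subgroup_normal)

lemma iter_comm_add:
  "iter_comm G (iter_comm G U V i) V j = iter_comm G U V (i + j)"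
  by (induction j) auto

lemma comm_subgroup_mono:
  "U \<subseteq> U' \<Longrightarrow> comm_subgroup G U V \<subseteq> comm_subgroup G U' V"
  unfolding comm_subgroup_def by (rule mono_generate) auto

lemma iter_comm_mono:
  "U \<subseteq> U' \<Longrightarrow> iter_comm G U V i \<subseteq> iter_comm G U' V i"
  by (induction i) (auto dest: comm_subgroup_mono)

lemma iter_comm_Suc_subset:
  assumes "U \<lhd> G"
  shows "iter_comm G U (carrier G) (Suc i) \<subseteq> iter_comm G U (carrier G) i"
proof -
  have n: "iter_comm G U (carrier G) i \<lhd> G"
    using assms iter_comm_normal normal_carrier by blast
  show ?thesis
    unfolding iter_comm.simps
    by (rule comm_subgroup_least) (use n gcomm_mem_normal normal_imp_subgroup in auto)
qed

lemma iter_comm_antimono: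
  assumes "U \<lhd> G" "i \<le> j"
  shows "iter_comm G U (carrier G) j \<subseteq> iter_comm G U (carrier G) i"
  using assms(2) by (induction j rule: dec_induct)
    (use iter_comm_Suc_subset[OF assms(1)] in blast)+

text \<open>An instance of the three subgroup lemma, extracted from the Hall-Witt identity.\<close>

lemma gcomm_iter_comm:
  assumes "U \<lhd> G" "u \<in> U" "x \<in> iter_comm G (carrier G) (carrier G) k"
  shows "gcomm G u x \<in> iter_comm G U (carrier G) (Suc k)"
  using assms
proof (induction k arbitrary: U u x)
  case 0
  then show ?case by (auto intro: gcomm_in_comm_subgroup)
next
  case (Suc k)
  let ?C = "carrier G"
  define N where "N = iter_comm G U ?C (Suc (Suc k))"
  have N: "N \<lhd> G" unfolding N_def using Suc.prems iter_comm_normal normal_carrier by blast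
  interpret N: normal N G by fact
  have uc: "u \<in> carrier G" if "u \<in> U" for u using Suc.prems that normal_mem_carrier by blast
  have U1: "comm_subgroup G U ?C \<lhd> G"
    using Suc.prems comm_subgroup_normal normal_carrier by blast
  \<comment> \<open>The elements whose commutators with all of \<open>U\<close> fall into the normal
    subgroup \<open>N\<close> form a subgroup, so it suffices to place the generators
    \<open>gcomm G x f\<close> of the next term in it.\<close>
  define D where "D = {y \<in> ?C. \<forall>u \<in> U. gcomm G u y \<in> N}"
  have D: "subgroup D G"
  proof
    show "D \<subseteq> ?C" by (auto simp: D_def)
    show "\<one> \<in> D" by (auto simp: D_def uc)
  next
    fix x y assume "x \<in> D" "y \<in> D"
    then show "x \<otimes> y \<in> D"
      by (auto simp: D_def gcomm_mult_right uc intro!: N.m_closed normal_conj[OF N])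
  next
    fix x assume x: "x \<in> D"
    have "gcomm G u (inv x) \<in> N" if u: "u \<in> U" for u
    proof -
      have "gcomm G u (inv x) = x \<otimes> inv (gcomm G u x) \<otimes> inv x"
        using x uc[OF u] by (simp add: gcomm_def m_assoc inv_mult_group D_def)
      then show ?thesis using x u N by (auto simp: D_def intro!: normal_conj)
    qed
    then show "inv x \<in> D" using x by (auto simp: D_def)
  qed
  let ?X = "iter_comm G ?C ?C k"
  have X: "?X \<lhd> G" using iter_comm_normal normal_carrier by blast
  have "gcomm G x f \<in> D" if x: "x \<in> ?X" and f: "f \<in> ?C" for x f
  proof -
    have xc: "x \<in> ?C" using x X normal_mem_carrier by blast
    have "gcomm G u (gcomm G x f) \<in> N" if u: "u \<in> U" for u
    proof -
      note u' = uc[OF u]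
      \<comment> \<open>Hall-Witt will be applied to \<open>x\<close>, \<open>inv f\<close>,
        \<open>u\<close>; the inverse makes \<open>gcomm G x f\<close> the inner commutator of the
        first factor.\<close>
      let ?f = "inv f"
      have fc: "?f \<in> ?C" using f by simp
      have "gcomm G u (inv x) \<in> iter_comm G U ?C (Suc k)"
        using Suc.IH[OF Suc.prems(1) u] x X normal.axioms(1) subgroup.m_inv_closed by metis
      then have 1: "gcomm G (gcomm G u (inv x)) ?f \<in> N"
        unfolding N_def using fc by (auto intro: gcomm_in_comm_subgroup)
      have "gcomm G (inv u) ?f \<in> comm_subgroup G U ?C"
        using u Suc.prems(1) fc normal.axioms(1) subgroup.m_inv_closed
        by (metis gcomm_in_comm_subgroup)
      then have "inv (gcomm G (inv u) ?f) \<in> comm_subgroup G U ?C"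
        using U1 normal.axioms(1) subgroup.m_inv_closed by metis
      then have "gcomm G ?f (inv u) \<in> comm_subgroup G U ?C"
        using u' fc by (simp only: gcomm_inv inv_closed)
      \<comment> \<open>Here the induction hypothesis is used for the normal subgroup
        \<open>[U, G]\<close> in place of \<open>U\<close>, which is why \<open>U\<close> is
        generalised in the induction.\<close>
      then have "gcomm G (gcomm G ?f (inv u)) x \<in> iter_comm G (iter_comm G U ?C 1) ?C (Suc k)"
        using Suc.IH[OF U1 _ x] by simp
      then have 2: "gcomm G (gcomm G ?f (inv u)) x \<in> N"
        unfolding N_def iter_comm_add by simp
      define a b d where "a = inv ?f \<otimes> gcomm G (gcomm G x (inv ?f)) u \<otimes> ?f"
        and "b = inv u \<otimes> gcomm G (gcomm G ?f (inv u)) x \<otimes> u"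
        and "d = inv x \<otimes> gcomm G (gcomm G u (inv x)) ?f \<otimes> x"
      have "a \<otimes> b \<otimes> d = \<one>"
        unfolding a_def b_def d_def using xc fc u' by (intro hall_witt) auto
      moreover have ac: "a \<in> ?C" unfolding a_def using xc fc u' by simp
      moreover have bd: "b \<in> N" "d \<in> N"
        unfolding b_def d_def using 1 2 N xc u' by (auto intro: normal_conj)
      \<comment> \<open>Two of the three Hall-Witt factors lie in \<open>N\<close>, hence so does
        the third; undoing its conjugation leaves \<open>gcomm G (gcomm G x f) u\<close>.\<close>
      ultimately have "a = inv (b \<otimes> d)"
        by (metis N.mem_carrier inv_equality m_assoc m_closed)
      then have "a \<in> N" using bd by simp
      then have "?f \<otimes> a \<otimes> inv ?f \<in> N" using N fc normal_conj by blast
      moreover have "?f \<otimes> a \<otimes> inv ?f = gcomm G (gcomm G x f) u"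
        unfolding a_def using xc f u' by (simp add: m_assoc)
      ultimately have "inv (gcomm G (gcomm G x f) u) \<in> N" by simp
      then show ?thesis using xc f u' by (simp only: gcomm_inv gcomm_closed)
    qed
    then show ?thesis using xc f by (auto simp: D_def)
  qed
  then have "iter_comm G ?C ?C (Suc k) \<subseteq> D"
    unfolding iter_comm.simps by (intro comm_subgroup_least D)
  then show ?case using Suc.prems unfolding D_def N_def by blast
qed

end

section \<open>Commutator subgroups under homomorphisms\<close>

lemma hom_gcomm:
  assumes "group_hom G H h" "x \<in> carrier G" "y \<in> carrier G"
  shows "h (gcomm G x y) = gcomm H (h x) (h y)"
proof -
  interpret group_hom G H h by fact
  show ?thesis using assms(2,3) by (simp add: gcomm_def)
qed

lemma image_comm_subgroup:
  assumes "group_hom G H h" "U \<subseteq> carrier G" "V \<subseteq> carrier G"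
  shows "h ` comm_subgroup G U V = comm_subgroup H (h ` U) (h ` V)"
proof -
  interpret group_hom G H h by fact
  have "h ` {gcomm G u v |u v. u \<in> U \<and> v \<in> V} = {gcomm H u v |u v. u \<in> h ` U \<and> v \<in> h ` V}"
    using assms hom_gcomm[OF assms(1)] by (auto simp: image_iff) (metis subsetD)+
  then show ?thesis
    unfolding comm_subgroup_def
    using generate_img[OF G.comm_subgroup_gen_subset[OF assms(2,3)]] by simp
qed

lemma iter_comm_subset:
  assumes "group G" "U \<subseteq> carrier G" "V \<subseteq> carrier G"
  shows "iter_comm G U V i \<subseteq> carrier G"
  using assms group.generate_incl[OF assms(1) group.comm_subgroup_gen_subset[OF assms(1)]]
  by (induction i) (auto simp: comm_subgroup_def)

lemma image_iter_comm:
  assumes "group_hom G H h" "U \<subseteq> carrier G" "V \<subseteq> carrier G"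
  shows "h ` iter_comm G U V i = iter_comm H (h ` U) (h ` V) i"
proof -
  have "group G" using assms(1) by (simp add: group_hom_def)
  then show ?thesis
    using assms iter_comm_subset[OF _ assms(2,3)]
    by (induction i) (simp_all add: image_comm_subgroup)
qed

section \<open>Free groups\<close>

text \<open>The case distinction inside \<open>reduce\<close>, named so that words act on reduced
  words by folding \<open>push\<close>. Each letter acts there as a permutation, and associativity
  of the product is read off from this action.\<close>

definition push :: "'a \<times> bool \<Rightarrow> ('a \<times> bool) list \<Rightarrow> ('a \<times> bool) list" where
  "push x w = (case w of [] \<Rightarrow> [x]
     | y # ys \<Rightarrow> (if fst x = fst y \<and> snd x \<noteq> snd y then ys else x # y # ys))"

definition inv_letter :: "'a \<times> bool \<Rightarrow> 'a \<times> bool" where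
  "inv_letter x = (fst x, \<not> snd x)"

lemma reduce_Cons [simp]: "reduce (x # w) = push x (reduce w)"
  by (simp add: push_def)

declare reduce.simps(2) [simp del]

lemma reduce_foldr: "reduce w = foldr push w []"
  by (induction w) simp_all

lemma inv_letter_inv_letter [simp]: "inv_letter (inv_letter x) = x"
  by (simp add: inv_letter_def)

lemma push_cases:
  obtains ys where "w = inv_letter x # ys" "push x w = ys"
  | "push x w = x # w" "\<And>ys. w \<noteq> inv_letter x # ys"
proof (cases "\<exists>ys. w = inv_letter x # ys")
  case True
  then obtain ys where "w = inv_letter x # ys" by blast
  then show thesis by (intro that(1)) (auto simp: push_def inv_letter_def)
next
  case False
  then have "push x w = x # w"
    by (cases w) (auto simp: push_def inv_letter_def prod_eq_iff)
  then show thesis using False by (intro that(2)) auto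
qed

lemma push_inv_letter [simp]: "push x (inv_letter x # w) = w"
  by (simp add: push_def inv_letter_def)

lemma length_reduce: "length (reduce w) \<le> length w"
proof (induction w)
  case (Cons x w)
  then show ?case by (cases x "reduce w" rule: push_cases) auto
qed simp

lemma reduced_ConsD:
  assumes "reduce (x # w) = x # w"
  shows "reduce w = w" "push x w = x # w"
proof -
  show 1: "reduce w = w"
    using assms length_reduce[of w] by (cases x "reduce w" rule: push_cases) auto
  then show "push x w = x # w" using assms by simp
qed

lemma reduced_push:
  assumes "reduce w = w"
  shows "reduce (push x w) = push x w"
proof (cases x w rule: push_cases)
  case (1 ys)
  then show ?thesis using assms reduced_ConsD(1)[of "inv_letter x" ys] by simp
qed (use assms in simp)

lemma reduce_reduce [simp]: "reduce (reduce w) = reduce w"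
  by (induction w) (simp_all add: reduced_push)

text \<open>If \<open>inv_letter x\<close> cancels the head of \<open>w\<close>, that head was
  \<open>x\<close>, and reducedness of \<open>w\<close> ensures that pushing \<open>x\<close> back
  restores it without a further cancellation.\<close>

lemma push_push_inv_letter:
  assumes "reduce w = w"
  shows "push x (push (inv_letter x) w) = w"
proof (cases "inv_letter x" w rule: push_cases)
  case (1 ys)
  then show ?thesis using assms reduced_ConsD(2)[of x ys] by simp
next
  case 2
  then show ?thesis using push_inv_letter[of x w] by simp
qed

lemma reduced_foldr_push:
  "reduce w = w \<Longrightarrow> reduce (foldr push u w) = foldr push u w"
  by (induction u) (simp_all add: reduced_push)

text \<open>A pair of letters removed by reduction acts as the identity on reduced words. This is
  the core of associativity in the free group.\<close>

lemma foldr_push_reduce: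
  assumes "reduce w = w"
  shows "foldr push (reduce u) w = foldr push u w"
proof (induction u)
  case (Cons x u)
  show ?case
  proof (cases x "reduce u" rule: push_cases)
    case (1 ys)
    then have "foldr push u w = push (inv_letter x) (foldr push ys w)"
      using Cons.IH by simp
    then show ?thesis
      using 1 push_push_inv_letter[OF reduced_foldr_push[OF assms]] by simp
  next
    case 2
    then show ?thesis using Cons.IH by simp
  qed
qed simp

lemma reduce_append: "reduce (u @ v) = foldr push u (reduce v)"
  by (simp add: reduce_foldr)

lemma reduce_append_reduce [simp]:
  "reduce (reduce u @ v) = reduce (u @ v)" "reduce (u @ reduce v) = reduce (u @ v)"
  by (simp_all add: reduce_append foldr_push_reduce)

lemma set_reduce: "set (reduce w) \<subseteq> set w"
proof (induction w)
  case (Cons x w)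
  then show ?case by (cases x "reduce w" rule: push_cases) auto
qed simp

lemma reduce_inverse: "reduce (rev (map inv_letter w) @ w) = []"
proof (induction w)
  case (Cons x w)
  have "push (inv_letter x) (push x (reduce w)) = reduce w"
    using push_push_inv_letter[of "reduce w" "inv_letter x"] by simp
  then show ?case using Cons by (simp add: reduce_append)
qed simp

lemma free_group_simps:
  "w \<in> carrier (free_group Q) \<longleftrightarrow> set w \<subseteq> Q \<times> UNIV \<and> reduce w = w"
  "u \<otimes>\<^bsub>free_group Q\<^esub> v = reduce (u @ v)"
  "\<one>\<^bsub>free_group Q\<^esub> = []"
  by (simp_all add: free_group_def)

lemma group_free_group: "group (free_group Q)"
proof (rule groupI; (unfold free_group_simps)?)
  fix x y
  assume "set x \<subseteq> Q \<times> UNIV \<and> reduce x = x" "set y \<subseteq> Q \<times> UNIV \<and> reduce y = y"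
  then show "set (reduce (x @ y)) \<subseteq> Q \<times> UNIV \<and> reduce (reduce (x @ y)) = reduce (x @ y)"
    using set_reduce[of "x @ y"] by auto
next
  fix x
  assume x: "set x \<subseteq> Q \<times> UNIV \<and> reduce x = x"
  let ?y = "reduce (rev (map inv_letter x))"
  have "set ?y \<subseteq> Q \<times> UNIV"
    using x set_reduce[of "rev (map inv_letter x)"] by (force simp: inv_letter_def)
  moreover have "reduce (?y @ x) = []" by (simp add: reduce_inverse)
  ultimately show "\<exists>y\<in>carrier (free_group Q). reduce (y @ x) = []"
    by (intro bexI[of _ ?y]) (auto simp: free_group_simps)
qed auto

section \<open>Evaluation of words and lifting through surjections\<close>

definition word_eval :: "('b, 'm) monoid_scheme \<Rightarrow> ('a \<Rightarrow> 'b) \<Rightarrow> ('a \<times> bool) list \<Rightarrow> 'b" where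
  "word_eval G f w = foldr (\<lambda>x a. (if snd x then f (fst x) else inv\<^bsub>G\<^esub> (f (fst x))) \<otimes>\<^bsub>G\<^esub> a) w \<one>\<^bsub>G\<^esub>"

context group
begin

lemma word_eval_simps [simp]:
  "word_eval G f [] = \<one>"
  "word_eval G f (x # w) = (if snd x then f (fst x) else inv (f (fst x))) \<otimes> word_eval G f w"
  by (simp_all add: word_eval_def)

context
  fixes f :: "'x \<Rightarrow> 'a" and Q :: "'x set"
  assumes f: "f ` Q \<subseteq> carrier G"
begin

lemma word_eval_closed:
  "set w \<subseteq> Q \<times> UNIV \<Longrightarrow> word_eval G f w \<in> carrier G"
  using f by (induction w) auto

lemma word_eval_append:
  "set u \<subseteq> Q \<times> UNIV \<Longrightarrow> set v \<subseteq> Q \<times> UNIV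
    \<Longrightarrow> word_eval G f (u @ v) = word_eval G f u \<otimes> word_eval G f v"
  using f by (induction u) (auto simp: word_eval_closed m_assoc)

lemma word_eval_reduce:
  "set w \<subseteq> Q \<times> UNIV \<Longrightarrow> word_eval G f (reduce w) = word_eval G f w"
proof (induction w)
  case (Cons x w)
  then have IH: "word_eval G f (reduce w) = word_eval G f w" by simp
  have x: "f (fst x) \<in> carrier G" using Cons.prems f by auto
  show ?case
  proof (cases x "reduce w" rule: push_cases)
    case (1 ys)
    then have "set ys \<subseteq> Q \<times> UNIV" using Cons.prems set_reduce[of w] by auto
    then show ?thesis
      using 1 IH x word_eval_closed[of ys] by (auto simp: inv_letter_def simp flip: IH)
  next
    case 2
    then show ?thesis using IH by simp
  qed
qed simp

lemma word_eval_hom: "word_eval G f \<in> hom (free_group Q) G"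
proof (rule homI)
  fix u v assume "u \<in> carrier (free_group Q)" "v \<in> carrier (free_group Q)"
  then show "word_eval G f (u \<otimes>\<^bsub>free_group Q\<^esub> v) = word_eval G f u \<otimes> word_eval G f v"
    using word_eval_reduce[of "u @ v"] by (simp add: free_group_simps word_eval_append)
qed (simp add: free_group_simps word_eval_closed)

end

end

text \<open>Free groups are projective: choose a preimage \<open>f y\<close> of each
  \<open>\<rho> [(y, True)]\<close> and extend by \<open>word_eval\<close>. The two maps agree on
  letters, and a reduced word is the product of its first letter and its tail.\<close>

lemma free_group_lift:
  assumes "group_hom P G \<pi>" "\<pi> ` carrier P = carrier G" "\<rho> \<in> hom (free_group Y) G"
  obtains \<alpha> where "\<alpha> \<in> hom (free_group Y) P" "\<And>w. w \<in> carrier (free_group Y) \<Longrightarrow> \<pi> (\<alpha> w) = \<rho> w"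
proof -
  interpret group_hom P G \<pi> by fact
  interpret Y: group "free_group Y" by (rule group_free_group)
  interpret \<rho>: group_hom "free_group Y" G \<rho>
    using assms(3) by unfold_locales
  have "\<exists>p. p \<in> carrier P \<and> \<pi> p = \<rho> [(y, True)]" if "y \<in> Y" for y
  proof -
    have "[(y, True)] \<in> carrier (free_group Y)"
      using that by (simp add: free_group_simps push_def)
    then have "\<rho> [(y, True)] \<in> \<pi> ` carrier P"
      unfolding assms(2) by (rule \<rho>.hom_closed)
    then show ?thesis by auto
  qed
  then obtain f where f: "\<And>y. y \<in> Y \<Longrightarrow> f y \<in> carrier P" "\<And>y. y \<in> Y \<Longrightarrow> \<pi> (f y) = \<rho> [(y, True)]"
    by metis
  then have fY: "f ` Y \<subseteq> carrier P" by auto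
  have letter: "\<rho> [x] = \<pi> (if snd x then f (fst x) else inv\<^bsub>P\<^esub> (f (fst x)))" if "fst x \<in> Y" for x
  proof (cases "snd x")
    case True
    then show ?thesis using f(2)[OF that] by (cases x) auto
  next
    case False
    have "[(fst x, True)] \<in> carrier (free_group Y)" "[x] \<in> carrier (free_group Y)"
      using that by (auto simp: free_group_simps push_def mem_Times_iff)
    moreover from False have "[x] \<otimes>\<^bsub>free_group Y\<^esub> [(fst x, True)] = \<one>\<^bsub>free_group Y\<^esub>"
      by (simp add: free_group_simps push_def)
    ultimately have "\<rho> [x] = inv\<^bsub>G\<^esub> \<rho> [(fst x, True)]"
      by (metis Y.inv_equality \<rho>.hom_inv)
    then show ?thesis using False f that by simp
  qed
  have "\<pi> (word_eval P f w) = \<rho> w" if "w \<in> carrier (free_group Y)" for w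
    using that
  proof (induction w)
    case Nil
    then show ?case using \<rho>.hom_one by (simp add: free_group_simps)
  next
    case (Cons x w)
    have "reduce (x # w) = x # w" and x: "fst x \<in> Y" and "set w \<subseteq> Y \<times> UNIV"
      using Cons.prems by (auto simp: free_group_simps)
    then have w: "w \<in> carrier (free_group Y)" and m: "x # w = [x] \<otimes>\<^bsub>free_group Y\<^esub> w"
      using reduced_ConsD[of x w] by (auto simp: free_group_simps)
    have "[x] \<in> carrier (free_group Y)" using x by (cases x) (auto simp: free_group_simps push_def)
    then have "\<rho> (x # w) = \<rho> [x] \<otimes>\<^bsub>G\<^esub> \<rho> w" using w by (simp add: m)
    moreover have "word_eval P f w \<in> carrier P"
      using G.word_eval_closed[OF fY] w by (simp add: free_group_simps)
    ultimately show ?case using Cons.IH[OF w] letter[OF x] x f(1) by simp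
  qed
  then show thesis using that G.word_eval_hom[OF fY] by blast
qed

section \<open>Generation, exponent and order\<close>

text \<open>Unlike \<open>min_gens\<close>, this asserts that a finite generating set exists; only
  then is the \<open>LEAST\<close> in \<open>min_gens\<close> attained.\<close>

definition gen_by :: "('a, 'm) monoid_scheme \<Rightarrow> nat \<Rightarrow> bool" where
  "gen_by A n \<longleftrightarrow> (\<exists>S. finite S \<and> card S \<le> n \<and> S \<subseteq> carrier A \<and> generate A S = carrier A)"

lemma gen_by_min_gens: "gen_by A n \<Longrightarrow> gen_by A (min_gens A)"
  unfolding gen_by_def min_gens_def
  by (rule LeastI2_ex) blast+

lemma min_gens_le: "gen_by A n \<Longrightarrow> min_gens A \<le> n"
  unfolding gen_by_def min_gens_def
  by (metis (mono_tags, lifting) Least_le order_trans)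

lemma gen_by_hom:
  assumes "group_hom A B h" "h ` carrier A = carrier B" "gen_by A n"
  shows "gen_by B n"
proof -
  interpret group_hom A B h by fact
  obtain S where S: "finite S" "card S \<le> n" "S \<subseteq> carrier A" "generate A S = carrier A"
    using assms(3) by (auto simp: gen_by_def)
  have "generate B (h ` S) = carrier B"
    using generate_img[OF S(3)] S(4) assms(2) by simp
  moreover have "card (h ` S) \<le> n" using card_image_le[OF S(1), of h] S(2) by simp
  ultimately show ?thesis unfolding gen_by_def using S by (intro exI[of _ "h ` S"]) auto
qed

section \<open>Subgroups and extensions of finitely generated groups\<close>

lemma (in comm_group) generate_insert:
  assumes "x \<in> carrier G" "S \<subseteq> carrier G" "y \<in> generate G (insert x S)"
  shows "\<exists>k::int. \<exists>d \<in> generate G S. y = x [^] k \<otimes> d"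
  using assms(3)
proof induction
  case one
  then show ?case by (intro exI[of _ 0] bexI[of _ \<one>]) (auto intro: generate.one)
next
  case (incl h)
  then consider "h = x" | "h \<in> S" by blast
  then show ?case
  proof cases
    case 1
    then show ?thesis using assms
      by (intro exI[of _ 1] bexI[of _ \<one>]) (auto intro: generate.one simp: int_pow_1)
  next
    case 2
    then show ?thesis using assms
      by (intro exI[of _ 0] bexI[of _ h]) (auto intro: generate.incl)
  qed
next
  case (inv h)
  then consider "h = x" | "h \<in> S" by blast
  then show ?case
  proof cases
    case 1
    then show ?thesis using assms
      by (intro exI[of _ "-1"] bexI[of _ \<one>]) (auto intro: generate.one simp: int_pow_neg int_pow_1)
  next
    case 2
    then show ?thesis using assms
      by (intro exI[of _ 0] bexI[of _ "inv h"]) (auto intro: generate.inv)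
  qed
next
  case (eng a b)
  then obtain k l :: int and d e where *: "d \<in> generate G S" "e \<in> generate G S"
    "a = x [^] k \<otimes> d" "b = x [^] l \<otimes> e" by blast
  moreover have "d \<in> carrier G" "e \<in> carrier G"
    using * generate_in_carrier[OF assms(2)] by auto
  ultimately have "a \<otimes> b = x [^] (k + l) \<otimes> (d \<otimes> e)"
    using assms(1) by (simp add: int_pow_mult m_ac)
  then show ?case using generate.eng[OF *(1,2)] by blast
qed

text \<open>Induction over the generators. The exponents of \<open>x\<close> occurring in
  \<open>H\<close> form an ideal of the integers; one element of \<open>H\<close> realising a
  generator of this ideal is added to the generators of \<open>H \<inter> generate G S\<close> given
  by induction.\<close>

lemma (in comm_group) subgroup_of_generate:
  assumes "finite S" "S \<subseteq> carrier G" "subgroup H G" "H \<subseteq> generate G S"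
  shows "\<exists>S'. finite S' \<and> card S' \<le> card S \<and> S' \<subseteq> H \<and> generate G S' = H"
  using assms
proof (induction S arbitrary: H rule: finite_induct)
  case empty
  then have "H = {\<one>}"
    using subgroup.one_closed[of H G] generate_empty by auto
  then show ?case using generate_empty by (intro exI[of _ "{}"]) auto
next
  case (insert x S)
  have x: "x \<in> carrier G" and S: "S \<subseteq> carrier G" using insert.prems by auto
  interpret H: subgroup H G by fact
  define D where "D = generate G S"
  have D: "subgroup D G" unfolding D_def using S by (rule generate_is_subgroup)
  interpret D: subgroup D G by fact
  have HD: "subgroup (H \<inter> D) G" using H.subgroup_axioms D by (rule subgroups_Inter_pair)
  obtain S' where S': "finite S'" "card S' \<le> card S" "S' \<subseteq> H \<inter> D" "generate G S' = H \<inter> D"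
    using insert.IH[OF S HD] by (auto simp: D_def)
  \<comment> \<open>The ideal of exponents of \<open>x\<close> in \<open>H\<close>. Closure under
    \<open>k - q * l\<close>, shown below, provides both remainders and negatives.\<close>
  define I where "I = {k::int. \<exists>d \<in> D. x [^] k \<otimes> d \<in> H}"
  have rep: "\<exists>k::int. \<exists>d \<in> D. h = x [^] k \<otimes> d" if "h \<in> H" for h
    unfolding D_def using insert.prems(3) that by (intro generate_insert[OF x S]) auto
  have I_diff: "k - q * l \<in> I" if kl: "k \<in> I" "l \<in> I" for k l q
  proof -
    obtain d e where de: "d \<in> D" "e \<in> D" "x [^] k \<otimes> d \<in> H" "x [^] l \<otimes> e \<in> H"
      using kl unfolding I_def by blast
    have "(x [^] l \<otimes> e) [^] (-q) \<in> H"
      using subgroup_int_pow_closed[OF H.subgroup_axioms de(4)] .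
    then have "x [^] k \<otimes> d \<otimes> (x [^] l \<otimes> e) [^] (-q) \<in> H"
      using de by simp
    moreover have "(x [^] l \<otimes> e) [^] (-q) = x [^] (l * -q) \<otimes> e [^] (-q)"
      using x de by (simp add: int_pow_distrib int_pow_pow del: mult_minus_right)
    moreover have "x [^] k \<otimes> d \<otimes> (x [^] (l * -q) \<otimes> e [^] (-q))
        = x [^] (k + l * -q) \<otimes> (d \<otimes> e [^] (-q))"
      unfolding int_pow_mult[OF x] using x de by (simp add: m_ac del: mult_minus_right)
    ultimately have "x [^] (k - q * l) \<otimes> (d \<otimes> e [^] (-q)) \<in> H"
      by (simp add: mult.commute)
    moreover have "d \<otimes> e [^] (-q) \<in> D"
      using de subgroup_int_pow_closed[OF D] by simp
    ultimately show ?thesis unfolding I_def by auto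
  qed
  \<comment> \<open>The ideal is principal: its generator is the least positive member, or 0 if
    there is none.\<close>
  have "\<exists>m \<in> I. \<forall>k \<in> I. m dvd k"
  proof (cases "\<exists>k \<in> I. k > 0")
    case True
    define m where "m = (LEAST n. n > 0 \<and> int n \<in> I)"
    have "\<exists>n. n > 0 \<and> int n \<in> I" using True by (metis zero_less_imp_eq_int)
    then have "m > 0 \<and> int m \<in> I" unfolding m_def by (rule LeastI_ex)
    then have m: "m > 0" "int m \<in> I" by auto
    have least: "m \<le> n" if "n > 0" "int n \<in> I" for n
      unfolding m_def using that by (intro Least_le) simp
    have "int m dvd k" if "k \<in> I" for k
    proof (rule ccontr)
      assume "\<not> int m dvd k"
      then have "k mod int m \<noteq> 0" by (simp add: mod_eq_0_iff_dvd)
      moreover have "k mod int m \<ge> 0" using m(1) by simp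
      ultimately have pos: "k mod int m > 0" by linarith
      moreover have "k mod int m \<in> I"
        using I_diff[OF that m(2), of "k div int m"] by (simp add: minus_div_mult_eq_mod)
      ultimately have "m \<le> nat (k mod int m)" using least by simp
      moreover have "k mod int m < int m" using m(1) by simp
      ultimately show False using pos by linarith
    qed
    then show ?thesis using m(2) by blast
  next
    case False
    have "x [^] (0::int) \<otimes> \<one> \<in> H" by simp
    then have 0: "0 \<in> I" unfolding I_def using D.one_closed by blast
    have "k = 0" if "k \<in> I" for k
    proof (rule ccontr)
      assume "k \<noteq> 0"
      moreover have "- k \<in> I" using I_diff[OF 0 that, of 1] by simp
      ultimately show False using False that by (metis linorder_neqE neg_0_less_iff_less)
    qed
    then show ?thesis using 0 by auto
  qed
  then obtain m d0 where m: "d0 \<in> D" "x [^] m \<otimes> d0 \<in> H" "\<And>k. k \<in> I \<Longrightarrow> m dvd k"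
    unfolding I_def by blast
  define h0 where "h0 = x [^] m \<otimes> d0"
  have h0: "h0 \<in> H" "h0 \<in> carrier G" using m by (auto simp: h0_def)
  have sub: "insert h0 S' \<subseteq> H" using h0 S' by auto
  then have "generate G (insert h0 S') \<subseteq> H"
    using H.subgroup_axioms by (intro generate_subgroup_incl)
  moreover have "h \<in> generate G (insert h0 S')" if h: "h \<in> H" for h
  proof -
    obtain k d where kd: "d \<in> D" "h = x [^] (k::int) \<otimes> d" using rep[OF h] by blast
    then have "k \<in> I" unfolding I_def using h by auto
    then obtain q where q: "k = m * q" using m(3) by blast
    \<comment> \<open>Dividing by the right power of \<open>h0\<close> removes the power of
      \<open>x\<close>, so the remainder lies in \<open>H \<inter> D\<close>, which
      \<open>S'\<close> generates.\<close>
    define e where "e = h \<otimes> h0 [^] (-q)"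
    have pw: "h0 [^] (-q) = x [^] (-k) \<otimes> d0 [^] (-q)"
      using x m by (simp add: h0_def q int_pow_distrib int_pow_pow)
    have "e = x [^] (k + -k) \<otimes> (d \<otimes> d0 [^] (-q))"
      unfolding e_def pw kd(2) int_pow_mult[OF x]
      using x kd m by (simp add: m_ac int_pow_neg)
    then have "e = d \<otimes> d0 [^] (-q)" using kd m by simp
    then have "e \<in> D" using kd m subgroup_int_pow_closed[OF D] by simp
    moreover have "e \<in> H" unfolding e_def using h h0 subgroup_int_pow_closed[OF H.subgroup_axioms] by simp
    ultimately have "e \<in> generate G S'" using S' by simp
    then have "e \<in> generate G (insert h0 S')" using mono_generate[of S' "insert h0 S'"] by blast
    moreover have "h0 [^] q \<in> generate G (insert h0 S')"
    proof (rule subgroup_int_pow_closed)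
      show "subgroup (generate G (insert h0 S')) G"
        using sub H.subset by (intro generate_is_subgroup) auto
    qed (auto intro: generate.incl)
    ultimately have "e \<otimes> h0 [^] q \<in> generate G (insert h0 S')" by (rule generate.eng)
    moreover have "e \<otimes> h0 [^] q = h"
      using h h0 by (simp add: e_def m_assoc int_pow_neg)
    ultimately show ?thesis by simp
  qed
  ultimately have "generate G (insert h0 S') = H" by blast
  moreover have "card (insert h0 S') \<le> card (insert x S)"
    using S' insert.hyps by (simp add: card_insert_if)
  ultimately show ?case using sub S' by blast
qed

lemma gen_by_subgroup:
  assumes "comm_group A" "subgroup H A" "gen_by A n"
  shows "gen_by (A\<lparr>carrier := H\<rparr>) n"
proof -
  interpret comm_group A by fact
  obtain S where S: "finite S" "card S \<le> n" "S \<subseteq> carrier A" "generate A S = carrier A"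
    using assms(3) by (auto simp: gen_by_def)
  then obtain S' where "finite S'" "card S' \<le> card S" "S' \<subseteq> H" "generate A S' = H"
    using subgroup_of_generate[OF S(1,3) assms(2)] subgroup.subset[OF assms(2)] by auto
  then show ?thesis unfolding gen_by_def
    using S generate_consistent[OF _ assms(2)] by (intro exI[of _ S']) auto
qed

text \<open>Lifts of generators of the image, chosen with exactly as many elements, generate
  \<open>A\<close> together with generators of the kernel.\<close>

lemma gen_by_extension:
  assumes "group_hom A B h" "gen_by (B\<lparr>carrier := h ` carrier A\<rparr>) m"
    and "gen_by (A\<lparr>carrier := kernel A B h\<rparr>) n"
  shows "gen_by A (m + n)"
proof -
  interpret group_hom A B h by fact
  obtain S where S: "finite S" "card S \<le> m" "S \<subseteq> h ` carrier A" "generate B S = h ` carrier A"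
    using assms(2) H.generate_consistent[OF _ img_is_subgroup] by (auto simp: gen_by_def)
  obtain S' where S': "finite S'" "card S' \<le> n" "S' \<subseteq> kernel A B h" "generate A S' = kernel A B h"
    using assms(3) G.generate_consistent[OF _ subgroup_kernel] by (auto simp: gen_by_def)
  obtain T where T: "T \<subseteq> carrier A" "S = h ` T" "finite T" "card T = card S"
    using S(1,3) by (metis subset_image_inj card_image finite_image_iff)
  have sub: "T \<union> S' \<subseteq> carrier A" using T S' by (auto simp: kernel_def)
  interpret D: subgroup "generate A (T \<union> S')" A
    using sub by (rule G.generate_is_subgroup)
  have "a \<in> generate A (T \<union> S')" if a: "a \<in> carrier A" for a
  proof -
    have "h a \<in> h ` generate A T"
      using a S(4) T(1,2) by (simp add: generate_img)
    then obtain b where b: "b \<in> generate A T" "h a = h b" by auto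
    then have b': "b \<in> generate A (T \<union> S')" using G.mono_generate[of T "T \<union> S'"] by blast
    then have "a \<otimes>\<^bsub>A\<^esub> inv\<^bsub>A\<^esub> b \<in> generate A S'"
      unfolding S'(4) using a b by (simp add: kernel_def)
    then have "a \<otimes>\<^bsub>A\<^esub> inv\<^bsub>A\<^esub> b \<in> generate A (T \<union> S')" using G.mono_generate[of S' "T \<union> S'"] by blast
    then have "(a \<otimes>\<^bsub>A\<^esub> inv\<^bsub>A\<^esub> b) \<otimes>\<^bsub>A\<^esub> b \<in> generate A (T \<union> S')" using b' by (rule D.m_closed)
    then show ?thesis using a b' by (simp add: G.m_assoc)
  qed
  then have "generate A (T \<union> S') = carrier A" using D.subset by blast
  moreover have "card (T \<union> S') \<le> m + n" using card_Un_le[of T S'] T(4) S(2) S'(2) by simp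
  ultimately show ?thesis unfolding gen_by_def using sub T S'
    by (intro exI[of _ "T \<union> S'"]) auto
qed

text \<open>This covers the value 0 too, which \<open>Lcm\<close> takes when some order is 0 or the
  orders are unbounded.\<close>

lemma pow_group_exponent:
  assumes "group A" "x \<in> carrier A"
  shows "x [^]\<^bsub>A\<^esub> group_exponent A = \<one>\<^bsub>A\<^esub>"
  using assms group.pow_eq_id[OF assms] by (auto simp: group_exponent_def intro: dvd_Lcm)

lemma group_exponent_dvd:
  assumes "group A" "\<And>x. x \<in> carrier A \<Longrightarrow> x [^]\<^bsub>A\<^esub> n = \<one>\<^bsub>A\<^esub>"
  shows "group_exponent A dvd n"
  unfolding group_exponent_def
  by (rule Lcm_least) (use assms group.pow_eq_id in fastforce)

text \<open>The first isomorphism theorem combined with Lagrange. Infinite groups are covered, their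
  \<open>order\<close> being 0.\<close>

lemma order_surj_hom:
  assumes "group_hom A B h" "h ` carrier A = carrier B"
  shows "order A = order B * card (kernel A B h)"
proof -
  interpret group_hom A B h by fact
  have "order (A Mod kernel A B h) = order B"
    using FactGroup_iso_set[OF assms(2)] by (auto simp: iso_def order_def dest: bij_betw_same_card)
  then show ?thesis
    using G.lagrange[OF subgroup_kernel] by (simp add: order_def FactGroup_def)
qed

section \<open>Subquotients\<close>

context group
begin

lemma coset_eq_iff:
  assumes "N \<lhd> G" "x \<in> carrier G" "y \<in> carrier G"
  shows "N #> x = N #> y \<longleftrightarrow> x \<otimes> inv y \<in> N"
proof -
  interpret N: normal N G by fact
  have "N #> x = N #> y \<longleftrightarrow> x \<in> N #> y"
    using assms N.subgroup_axioms rcos_self repr_independence by metis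
  then show ?thesis using N.rcos_module[OF is_group assms(3,2)] by simp
qed

lemma coset_eqE:
  assumes "N \<lhd> G" "x \<in> carrier G" "y \<in> carrier G" "N #> x = N #> y"
  obtains n where "n \<in> N" "y = n \<otimes> x"
proof
  show "y \<otimes> inv x \<in> N" using assms coset_eq_iff by metis
  show "y = y \<otimes> inv x \<otimes> x" using assms(2,3) by (simp add: m_assoc)
qed

lemma coset_absorb:
  assumes "N \<lhd> G" "n \<in> N" "x \<in> carrier G"
  shows "N #> (n \<otimes> x) = N #> x" "N #> (x \<otimes> n) = N #> x"
  using assms normal_conj(2)[OF assms] normal_mem_carrier[OF assms(1,2)]
  by (simp_all add: coset_eq_iff m_assoc)

text \<open>Expanding both products leaves \<open>gcomm G x f\<close> times conjugates of
  commutators lying in \<open>N\<close>. This is the inductive step of every congruence between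
  iterated commutators below.\<close>

lemma gcomm_coset_cong:
  assumes N: "N \<lhd> G"
    and c: "n \<in> carrier G" "x \<in> carrier G" "z \<in> carrier G" "f \<in> carrier G"
    and n: "\<And>g. g \<in> carrier G \<Longrightarrow> gcomm G n g \<in> N" and z: "gcomm G x z \<in> N"
  shows "N #> gcomm G (n \<otimes> x) (z \<otimes> f) = N #> gcomm G x f"
proof -
  have 1: "gcomm G (n \<otimes> x) (z \<otimes> f) = (inv x \<otimes> gcomm G n (z \<otimes> f) \<otimes> x) \<otimes> gcomm G x (z \<otimes> f)"
    using c by (simp add: gcomm_mult_left)
  have 2: "gcomm G x (z \<otimes> f) = gcomm G x f \<otimes> (inv f \<otimes> gcomm G x z \<otimes> f)"
    using c by (simp add: gcomm_mult_right)
  have "inv x \<otimes> gcomm G n (z \<otimes> f) \<otimes> x \<in> N" "inv f \<otimes> gcomm G x z \<otimes> f \<in> N"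
    using c n z by (auto intro!: normal_conj[OF N])
  then show ?thesis
    unfolding 1 2 using c by (simp add: coset_absorb[OF N])
qed

text \<open>The only deviation from additivity is a conjugate of
  \<open>gcomm G (gcomm G x f) y\<close>.\<close>

lemma gcomm_coset_mult_left:
  assumes N: "N \<lhd> G"
    and c: "x \<in> carrier G" "y \<in> carrier G" "f \<in> carrier G"
    and y: "gcomm G (gcomm G x f) y \<in> N"
  shows "N #> gcomm G (x \<otimes> y) f = N #> (gcomm G x f \<otimes> gcomm G y f)"
proof -
  let ?a = "gcomm G x f" and ?b = "gcomm G y f" and ?k = "gcomm G (gcomm G x f) y"
  have "gcomm G (x \<otimes> y) f = ?a \<otimes> ?k \<otimes> ?b"
    using c by (simp add: gcomm_mult_left gcomm_def[of G ?a] m_assoc)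
  also have "\<dots> = (?a \<otimes> ?k \<otimes> inv ?a) \<otimes> (?a \<otimes> ?b)"
    using c by (simp add: m_assoc)
  finally show ?thesis
    using c y normal_conj(2)[OF N y, of ?a] by (simp add: coset_absorb[OF N])
qed

text \<open>With \<open>a = [x, f]\<close> and \<open>b = [x, g]\<close> one has
  \<open>[x, f g] = a b [b, a] [a, g]\<close>, and both correction terms are commutators with
  \<open>a\<close> up to inversion.\<close>

lemma gcomm_coset_mult_right:
  assumes N: "N \<lhd> G"
    and c: "x \<in> carrier G" "f \<in> carrier G" "g \<in> carrier G"
    and k: "\<And>y. y \<in> carrier G \<Longrightarrow> gcomm G (gcomm G x f) y \<in> N"
  shows "N #> gcomm G x (f \<otimes> g) = N #> (gcomm G x f \<otimes> gcomm G x g)"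
proof -
  let ?a = "gcomm G x f" and ?b = "gcomm G x g"
  have "gcomm G x (f \<otimes> g) = (?a \<otimes> ?b) \<otimes> gcomm G ?b ?a \<otimes> gcomm G ?a g"
    using c by (simp add: gcomm_mult_right gcomm_def[of G ?a] gcomm_def[of G ?b ?a] m_assoc)
  moreover have "gcomm G ?b ?a \<in> N"
  proof -
    have "inv (gcomm G ?a ?b) \<in> N"
      using c k by (meson N gcomm_closed normal.axioms(1) subgroup.m_inv_closed)
    then show ?thesis using c by (simp add: gcomm_inv)
  qed
  ultimately show ?thesis
    using c k[of g] by (simp add: coset_absorb[OF N])
qed

lemma subquot_carrier: "carrier (G\<lparr>carrier := H\<rparr> Mod N) = (\<lambda>x. N #> x) ` H"
  by (simp add: carrier_FactGroup r_coset_def)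

lemma subquot_one: "\<one>\<^bsub>G\<lparr>carrier := H\<rparr> Mod N\<^esub> = N"
  by simp

context
  fixes N H
  assumes N: "N \<lhd> G" and H: "subgroup H G" and NH: "N \<subseteq> H"
begin

lemma subquot_normal: "N \<lhd> G\<lparr>carrier := H\<rparr>"
  using normal_restrict_supergroup[OF H N NH] .

lemma subquot_group: "group (G\<lparr>carrier := H\<rparr> Mod N)"
  using subquot_normal by (rule normal.factorgroup_is_group)

lemma subquot_mult:
  assumes "x \<in> carrier G" "y \<in> carrier G"
  shows "(N #> x) \<otimes>\<^bsub>G\<lparr>carrier := H\<rparr> Mod N\<^esub> (N #> y) = N #> (x \<otimes> y)"
  using normal.rcos_sum[OF N assms] by (simp add: set_mult_def)

lemma subquot_proj: "group_hom (G\<lparr>carrier := H\<rparr>) (G\<lparr>carrier := H\<rparr> Mod N) (\<lambda>x. N #> x)"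
proof -
  have "group (G\<lparr>carrier := H\<rparr>)" using H by (rule subgroup_imp_group)
  moreover have "(\<lambda>x. N #> x) \<in> hom (G\<lparr>carrier := H\<rparr>) (G\<lparr>carrier := H\<rparr> Mod N)"
    using normal.r_coset_hom_Mod[OF subquot_normal] by (simp add: r_coset_def)
  ultimately show ?thesis
    using subquot_group by (simp add: group_hom_def group_hom_axioms_def)
qed

lemma subquot_comm:
  assumes "\<And>x y. x \<in> H \<Longrightarrow> y \<in> H \<Longrightarrow> gcomm G x y \<in> N"
  shows "comm_group (G\<lparr>carrier := H\<rparr> Mod N)"
proof (rule group.group_comm_groupI[OF subquot_group], unfold subquot_carrier)
  fix U V assume "U \<in> (\<lambda>x. N #> x) ` H" "V \<in> (\<lambda>x. N #> x) ` H"
  then obtain x y where xy: "U = N #> x" "V = N #> y" "x \<in> H" "y \<in> H" by blast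
  have c: "x \<in> carrier G" "y \<in> carrier G" using xy subgroup.mem_carrier[OF H] by auto
  have "x \<otimes> y = (y \<otimes> x) \<otimes> gcomm G x y" using c by (simp add: gcomm_def m_assoc)
  then have "N #> (x \<otimes> y) = N #> (y \<otimes> x)"
    using c assms xy by (simp add: coset_absorb[OF N])
  then show "U \<otimes>\<^bsub>G\<lparr>carrier := H\<rparr> Mod N\<^esub> V = V \<otimes>\<^bsub>G\<lparr>carrier := H\<rparr> Mod N\<^esub> U"
    using c by (simp add: xy subquot_mult del: mult_FactGroup)
qed

lemma subquot_lift:
  assumes "group B" "f \<in> hom (G\<lparr>carrier := H\<rparr>) B" "\<And>n. n \<in> N \<Longrightarrow> f n = \<one>\<^bsub>B\<^esub>"
  obtains g where "g \<in> hom (G\<lparr>carrier := H\<rparr> Mod N) B" "\<And>x. x \<in> H \<Longrightarrow> g (N #> x) = f x"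
proof -
  interpret f: group_hom "G\<lparr>carrier := H\<rparr>" B f
    using assms(1,2) subgroup_imp_group[OF H] by (simp add: group_hom_def group_hom_axioms_def)
  have "N \<subseteq> kernel (G\<lparr>carrier := H\<rparr>) B f"
    using assms(3) NH by (auto simp: kernel_def)
  from f.FactGroup_universal_kernel[OF subquot_normal this] show thesis
    using that by (auto simp: r_coset_def)
qed

end

text \<open>The projection from \<open>B/N\<close> onto \<open>B/A\<close> has kernel
  \<open>A/N\<close>.\<close>

lemma subquot_order_tower:
  assumes "N \<lhd> G" "A \<lhd> G" "subgroup B G" "N \<subseteq> A" "A \<subseteq> B"
  shows "order (G\<lparr>carrier := B\<rparr> Mod N)
       = order (G\<lparr>carrier := B\<rparr> Mod A) * order (G\<lparr>carrier := A\<rparr> Mod N)"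
proof -
  note NB = subset_trans[OF assms(4,5)]
  interpret q: group_hom "G\<lparr>carrier := B\<rparr>" "G\<lparr>carrier := B\<rparr> Mod A" "\<lambda>x. A #> x"
    using assms by (intro subquot_proj)
  have A: "subgroup A G" using assms(2) by (rule normal_imp_subgroup)
  have Bc: "x \<in> carrier G" if "x \<in> B" for x using subgroup.mem_carrier[OF assms(3) that] .
  have 1: "A #> n = \<one>\<^bsub>G\<lparr>carrier := B\<rparr> Mod A\<^esub>" if "n \<in> N" for n
    using that assms(4) A coset_join2 subgroup.mem_carrier[OF A] by auto
  obtain g where g: "g \<in> hom (G\<lparr>carrier := B\<rparr> Mod N) (G\<lparr>carrier := B\<rparr> Mod A)"
    "\<And>x. x \<in> B \<Longrightarrow> g (N #> x) = A #> x"
    using subquot_lift[OF assms(1,3) NB q.H.is_group q.homh 1] by blast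
  have gh: "group_hom (G\<lparr>carrier := B\<rparr> Mod N) (G\<lparr>carrier := B\<rparr> Mod A) g"
    using g(1) subquot_group[OF assms(1,3) NB] by (simp add: group_hom_def group_hom_axioms_def)
  have im: "g ` carrier (G\<lparr>carrier := B\<rparr> Mod N) = carrier (G\<lparr>carrier := B\<rparr> Mod A)"
    using g(2) by (force simp: subquot_carrier image_image)
  have "kernel (G\<lparr>carrier := B\<rparr> Mod N) (G\<lparr>carrier := B\<rparr> Mod A) g = carrier (G\<lparr>carrier := A\<rparr> Mod N)"
  proof -
    have "A #> x = A \<longleftrightarrow> x \<in> A" if "x \<in> B" for x
      using Bc[OF that] A coset_join1 coset_join2 by metis
    then show ?thesis
      using g(2) assms(5) unfolding kernel_def subquot_carrier subquot_one by auto
  qed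
  then show ?thesis using order_surj_hom[OF gh im] by (simp add: order_def)
qed

lemma subquot_order_image:
  assumes "subgroup B G" "group_hom (G\<lparr>carrier := B\<rparr>) B' \<phi>"
    and "\<phi> ` B = carrier B'" "A = kernel (G\<lparr>carrier := B\<rparr>) B' \<phi>"
  shows "order (G\<lparr>carrier := B\<rparr> Mod A) = order B'"
proof -
  interpret \<phi>: group_hom "G\<lparr>carrier := B\<rparr>" B' \<phi> by fact
  show ?thesis
    using \<phi>.FactGroup_iso_set assms(3,4) by (auto simp: iso_def order_def dest: bij_betw_same_card)
qed

end

text \<open>The product of cosets does not refer to the carrier, so a subgroup of a quotient and the
  quotient of its preimage are equal as records and can be rewritten into each other.\<close>

lemma subquot_restrict:
  "(G\<lparr>carrier := A\<rparr> Mod N)\<lparr>carrier := (\<lambda>x. N #>\<^bsub>G\<^esub> x) ` H\<rparr> = G\<lparr>carrier := H\<rparr> Mod N"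
proof -
  have "(\<lambda>x. N #>\<^bsub>G\<^esub> x) ` H = rcosets\<^bsub>G\<lparr>carrier := H\<rparr>\<^esub> N"
    by (auto simp: RCOSETS_def r_coset_def)
  moreover have "set_mult (G\<lparr>carrier := A\<rparr>) = set_mult (G\<lparr>carrier := H\<rparr>)"
    by (simp add: set_mult_def fun_eq_iff)
  ultimately show ?thesis by (simp add: FactGroup_def)
qed

section \<open>Independence of the presentation\<close>

text \<open>Attached to an arbitrary group \<open>F\<close> with a subgroup \<open>R\<close>: the
  exact sequence holds in this generality, and freeness enters only when presentations are
  compared.\<close>

definition rel_multiplier :: "nat \<Rightarrow> ('a, 'm) monoid_scheme \<Rightarrow> 'a set \<Rightarrow> 'a set monoid" where
  "rel_multiplier c F R =
     (F\<lparr>carrier := R \<inter> lcs F (carrier F) (c + 1)\<rparr>) Mod (iter_comm F R (carrier F) c)"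

lemma c_multiplier_eq:
  "c_multiplier c Q \<pi> G = rel_multiplier c (free_group Q) (kernel (free_group Q) G \<pi>)"
  by (simp add: c_multiplier_def rel_multiplier_def Let_def)

lemma lcs_Suc [simp]: "lcs G S (Suc k) = iter_comm G S S k"
  by (simp add: lcs_def)

lemma iter_comm_mono2:
  assumes "group G" "U \<subseteq> U'" "V \<subseteq> V'"
  shows "iter_comm G U V i \<subseteq> iter_comm G U' V' i"
proof (induction i)
  case (Suc i)
  then have "{gcomm G u v |u v. u \<in> iter_comm G U V i \<and> v \<in> V}
      \<subseteq> {gcomm G u v |u v. u \<in> iter_comm G U' V' i \<and> v \<in> V'}"
    using assms(3) by blast
  then show ?case
    unfolding iter_comm.simps comm_subgroup_def by (rule group.mono_generate[OF assms(1)])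
qed (use assms in simp)

context group
begin

lemma lcs_normal: "lcs G (carrier G) k \<lhd> G"
  unfolding lcs_def by (intro iter_comm_normal normal_carrier)

lemma gcomm_Suc_iter_comm:
  assumes "x \<in> iter_comm G U (carrier G) i" "f \<in> carrier G"
  shows "gcomm G x f \<in> iter_comm G U (carrier G) (Suc i)"
  using assms by (auto intro: gcomm_in_comm_subgroup)

lemma gcomm_iter_comm':
  assumes "U \<lhd> G" "u \<in> U" "x \<in> iter_comm G (carrier G) (carrier G) k"
  shows "gcomm G x u \<in> iter_comm G U (carrier G) (Suc k)"
proof -
  have "subgroup (iter_comm G U (carrier G) (Suc k)) G"
    using assms(1) by (intro normal_imp_subgroup iter_comm_normal normal_carrier)
  then have "inv (gcomm G u x) \<in> iter_comm G U (carrier G) (Suc k)"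
    using gcomm_iter_comm[OF assms] by (rule subgroup.m_inv_closed)
  moreover have "x \<in> carrier G"
    using assms(3) iter_comm_normal[OF normal_carrier normal_carrier] normal_mem_carrier by blast
  ultimately show ?thesis using normal_mem_carrier[OF assms(1,2)] by (simp only: gcomm_inv)
qed

context
  fixes R and c :: nat
  assumes R: "R \<lhd> G"
begin

lemma rel_multiplier_sub:
  "iter_comm G R (carrier G) c \<lhd> G" "subgroup (R \<inter> lcs G (carrier G) (c + 1)) G"
  "iter_comm G R (carrier G) c \<subseteq> R \<inter> lcs G (carrier G) (c + 1)"
proof -
  show "iter_comm G R (carrier G) c \<lhd> G" using R by (intro iter_comm_normal normal_carrier)
  show "subgroup (R \<inter> lcs G (carrier G) (c + 1)) G"
    using R lcs_normal by (intro normal_imp_subgroup normal_subgroup_intersect)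
  have "iter_comm G R (carrier G) c \<subseteq> R"
    using iter_comm_antimono[OF R, of 0 c] by simp
  moreover have "R \<subseteq> carrier G" using R normal_mem_carrier by blast
  ultimately show "iter_comm G R (carrier G) c \<subseteq> R \<inter> lcs G (carrier G) (c + 1)"
    using iter_comm_mono[of R "carrier G" "carrier G" c] by simp
qed

text \<open>By the three subgroup lemma a commutator of \<open>R\<close> with
  \<open>\<gamma>\<^sub>c\<^sub>+\<^sub>1(G)\<close> already lies in
  \<open>[R,\<^sub>c\<^sub>+\<^sub>1G]\<close>, one term below the denominator.\<close>

lemma comm_group_rel_multiplier: "comm_group (rel_multiplier c G R)"
  unfolding rel_multiplier_def
proof (rule subquot_comm[OF rel_multiplier_sub])
  fix x y assume "x \<in> R \<inter> lcs G (carrier G) (c + 1)" "y \<in> R \<inter> lcs G (carrier G) (c + 1)"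
  then have "gcomm G x y \<in> iter_comm G R (carrier G) (Suc c)"
    using gcomm_iter_comm[OF R] by simp
  then show "gcomm G x y \<in> iter_comm G R (carrier G) c"
    using iter_comm_Suc_subset[OF R] by blast
qed

end

text \<open>Induction on \<open>k\<close>: \<open>\<phi>\<close> changes the left entry of a
  commutator by an element of \<open>[R,\<^sub>kG]\<close> and the right entry by an element of
  \<open>R\<close>, and \<open>[R,\<^sub>k\<^sub>+\<^sub>1G]\<close> absorbs both changes. It is
  applied to composites of lifts between two presentations.\<close>

lemma hom_cong_iter_comm:
  assumes R: "R \<lhd> G" and \<phi>: "\<phi> \<in> hom G G"
    and cong: "\<And>f. f \<in> carrier G \<Longrightarrow> R #> \<phi> f = R #> f"
    and x: "x \<in> iter_comm G (carrier G) (carrier G) k"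
  shows "iter_comm G R (carrier G) k #> \<phi> x = iter_comm G R (carrier G) k #> x"
  using x
proof (induction k arbitrary: x)
  case 0
  then show ?case using cong by simp
next
  case (Suc k)
  let ?C = "carrier G"
  let ?\<Gamma> = "iter_comm G ?C ?C k" and ?K = "iter_comm G R ?C k"
  define N where "N = iter_comm G R ?C (Suc k)"
  have N: "N \<lhd> G" unfolding N_def using R by (intro iter_comm_normal normal_carrier)
  have K: "?K \<lhd> G" using R by (intro iter_comm_normal normal_carrier)
  interpret N: normal N G by fact
  interpret \<phi>: group_hom G G \<phi> using \<phi> by unfold_locales
  define D where "D = {x \<in> ?C. N #> \<phi> x = N #> x}"
  have D: "subgroup D G"
  proof
    fix x y assume xy: "x \<in> D" "y \<in> D"
    then show "x \<otimes> y \<in> D"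
      by (auto simp: D_def simp flip: N.rcos_sum)
  next
    fix x assume x: "x \<in> D"
    then have "inv (\<phi> x) \<otimes> (\<phi> x \<otimes> inv x) \<otimes> inv (inv (\<phi> x)) \<in> N"
      unfolding D_def by (intro normal_conj(2)[OF N]) (auto simp: coset_eq_iff[OF N])
    then have "inv (\<phi> (inv x) \<otimes> inv (inv x)) \<in> N"
      using x by (simp add: D_def m_assoc inv_mult_group)
    then have "\<phi> (inv x) \<otimes> inv (inv x) \<in> N"
      using x by (metis (mono_tags, lifting) D_def N.m_inv_closed \<phi>.hom_closed inv_closed inv_inv
          m_closed mem_Collect_eq)
    then show "inv x \<in> D" using x by (simp add: D_def coset_eq_iff[OF N])
  qed (auto simp: D_def)
  have "gcomm G x f \<in> D" if x: "x \<in> ?\<Gamma>" and f: "f \<in> ?C" for x f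
  proof -
    have xc: "x \<in> ?C"
      using x iter_comm_normal[OF normal_carrier normal_carrier] normal_mem_carrier by blast
    obtain n where n: "n \<in> ?K" "\<phi> x = n \<otimes> x"
      using coset_eqE[OF K xc _ Suc.IH[OF x, symmetric]] xc by auto
    obtain r where r: "r \<in> R" "\<phi> f = r \<otimes> f"
      using coset_eqE[OF R f _ cong[OF f, symmetric]] f by auto
    have "N #> gcomm G (n \<otimes> x) (r \<otimes> f) = N #> gcomm G x f"
    proof (rule gcomm_coset_cong[OF N])
      show "n \<in> ?C" "r \<in> ?C" using n r R K normal_mem_carrier by blast+
      show "gcomm G n g \<in> N" if "g \<in> ?C" for g
        unfolding N_def using n(1) that by (rule gcomm_Suc_iter_comm)
      show "gcomm G x r \<in> N" unfolding N_def using R r(1) x by (rule gcomm_iter_comm')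
    qed (use xc f in auto)
    then show ?thesis
      using xc f hom_gcomm[OF \<phi>.group_hom_axioms xc f] by (simp add: D_def n r)
  qed
  then have "iter_comm G ?C ?C (Suc k) \<subseteq> D"
    unfolding iter_comm.simps by (intro comm_subgroup_least D)
  then show ?case using Suc.prems unfolding D_def N_def by blast
qed

end

text \<open>Functoriality, used for lifts between presentations and, with \<open>F = F'\<close>, for
  an inclusion of relation subgroups.\<close>

lemma rel_multiplier_map:
  assumes "group_hom F F' \<alpha>" "R \<lhd> F" "R' \<lhd> F'" "\<alpha> ` R \<subseteq> R'"
  obtains h where "h \<in> hom (rel_multiplier c F R) (rel_multiplier c F' R')"
    "\<And>x. x \<in> R \<inter> lcs F (carrier F) (c + 1)
      \<Longrightarrow> \<alpha> x \<in> R' \<inter> lcs F' (carrier F') (c + 1)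
        \<and> h (iter_comm F R (carrier F) c #>\<^bsub>F\<^esub> x) = iter_comm F' R' (carrier F') c #>\<^bsub>F'\<^esub> \<alpha> x"
proof -
  interpret \<alpha>: group_hom F F' \<alpha> by fact
  let ?K = "iter_comm F R (carrier F) c" and ?K' = "iter_comm F' R' (carrier F') c"
  let ?A = "R \<inter> lcs F (carrier F) (c + 1)" and ?A' = "R' \<inter> lcs F' (carrier F') (c + 1)"
  note s = \<alpha>.G.rel_multiplier_sub[OF assms(2), of c] and s' = \<alpha>.H.rel_multiplier_sub[OF assms(3), of c]
  have RF: "R \<subseteq> carrier F" using assms(2) \<alpha>.G.normal_mem_carrier by blast
  have im: "\<alpha> ` carrier F \<subseteq> carrier F'" by auto
  have K: "\<alpha> ` ?K \<subseteq> ?K'"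
    using iter_comm_mono2[OF \<alpha>.H.is_group assms(4) im]
    by (simp add: image_iter_comm[OF assms(1) RF])
  have "\<alpha> ` lcs F (carrier F) (c + 1) \<subseteq> lcs F' (carrier F') (c + 1)"
    using iter_comm_mono2[OF \<alpha>.H.is_group im im]
    by (simp add: image_iter_comm[OF assms(1)])
  then have A: "\<alpha> x \<in> ?A'" if "x \<in> ?A" for x using that assms(4) by blast
  have Ac: "x \<in> carrier F" if "x \<in> ?A" for x using that RF by blast
  have Ac': "x \<in> carrier F'" if "x \<in> ?A'" for x using that assms(3) \<alpha>.H.normal_mem_carrier by blast
  interpret q': group_hom "F'\<lparr>carrier := ?A'\<rparr>" "rel_multiplier c F' R'" "\<lambda>x. ?K' #>\<^bsub>F'\<^esub> x"
    unfolding rel_multiplier_def by (rule \<alpha>.H.subquot_proj[OF s'])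
  have hom: "(\<lambda>x. ?K' #>\<^bsub>F'\<^esub> \<alpha> x) \<in> hom (F\<lparr>carrier := ?A\<rparr>) (rel_multiplier c F' R')"
  proof (rule homI)
    show "?K' #>\<^bsub>F'\<^esub> \<alpha> x \<in> carrier (rel_multiplier c F' R')" if "x \<in> carrier (F\<lparr>carrier := ?A\<rparr>)" for x
      using A that q'.hom_closed by simp
    show "?K' #>\<^bsub>F'\<^esub> \<alpha> (x \<otimes>\<^bsub>F\<lparr>carrier := ?A\<rparr>\<^esub> y) =
      (?K' #>\<^bsub>F'\<^esub> \<alpha> x) \<otimes>\<^bsub>rel_multiplier c F' R'\<^esub> (?K' #>\<^bsub>F'\<^esub> \<alpha> y)"
      if "x \<in> carrier (F\<lparr>carrier := ?A\<rparr>)" "y \<in> carrier (F\<lparr>carrier := ?A\<rparr>)" for x y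
      using q'.hom_mult[of "\<alpha> x" "\<alpha> y"] that A Ac by simp
  qed
  have one: "?K' #>\<^bsub>F'\<^esub> \<alpha> n = \<one>\<^bsub>rel_multiplier c F' R'\<^esub>" if "n \<in> ?K" for n
  proof -
    have "\<alpha> n \<in> ?K'" using K that by blast
    moreover have "subgroup ?K' F'" using s'(1) by (rule normal_imp_subgroup)
    ultimately show ?thesis
      using \<alpha>.H.coset_join2 \<alpha>.H.normal_mem_carrier[OF s'(1)] by (simp add: rel_multiplier_def)
  qed
  obtain g where "g \<in> hom (rel_multiplier c F R) (rel_multiplier c F' R')"
    "\<And>x. x \<in> ?A \<Longrightarrow> g (?K #>\<^bsub>F\<^esub> x) = ?K' #>\<^bsub>F'\<^esub> \<alpha> x"
    using \<alpha>.G.subquot_lift[OF s q'.H.is_group hom one] unfolding rel_multiplier_def by blast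
  then show thesis using that A by blast
qed

text \<open>Both composites of \<open>\<alpha>\<close> and \<open>\<beta>\<close> induce the
  identity on \<open>G\<close>, so by \<open>hom_cong_iter_comm\<close> the induced maps of
  multipliers are mutually inverse.\<close>

lemma rel_multiplier_iso:
  assumes \<pi>: "group_hom F G \<pi>" and \<pi>': "group_hom F' G \<pi>'"
    and \<alpha>: "\<alpha> \<in> hom F F'" "\<And>x. x \<in> carrier F \<Longrightarrow> \<pi>' (\<alpha> x) = \<pi> x"
    and \<beta>: "\<beta> \<in> hom F' F" "\<And>x. x \<in> carrier F' \<Longrightarrow> \<pi> (\<beta> x) = \<pi>' x"
  shows "rel_multiplier c F (kernel F G \<pi>) \<cong> rel_multiplier c F' (kernel F' G \<pi>')"
proof -
  interpret \<pi>: group_hom F G \<pi> by fact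
  interpret \<pi>': group_hom F' G \<pi>' by fact
  interpret \<alpha>: group_hom F F' \<alpha> using \<alpha>(1) by unfold_locales
  interpret \<beta>: group_hom F' F \<beta> using \<beta>(1) by unfold_locales
  let ?R = "kernel F G \<pi>" and ?R' = "kernel F' G \<pi>'"
  let ?K = "iter_comm F ?R (carrier F) c" and ?K' = "iter_comm F' ?R' (carrier F') c"
  let ?A = "?R \<inter> lcs F (carrier F) (c + 1)" and ?A' = "?R' \<inter> lcs F' (carrier F') (c + 1)"
  have \<alpha>R: "\<alpha> ` ?R \<subseteq> ?R'" and \<beta>R: "\<beta> ` ?R' \<subseteq> ?R"
    using \<alpha>(2) \<beta>(2) by (auto simp: kernel_def)
  obtain h where h: "h \<in> hom (rel_multiplier c F ?R) (rel_multiplier c F' ?R')"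
    "\<And>x. x \<in> ?A \<Longrightarrow> \<alpha> x \<in> ?A' \<and> h (?K #>\<^bsub>F\<^esub> x) = ?K' #>\<^bsub>F'\<^esub> \<alpha> x"
    using rel_multiplier_map[OF \<alpha>.group_hom_axioms \<pi>.normal_kernel \<pi>'.normal_kernel \<alpha>R] by blast
  obtain g where g: "g \<in> hom (rel_multiplier c F' ?R') (rel_multiplier c F ?R)"
    "\<And>x. x \<in> ?A' \<Longrightarrow> \<beta> x \<in> ?A \<and> g (?K' #>\<^bsub>F'\<^esub> x) = ?K #>\<^bsub>F\<^esub> \<beta> x"
    using rel_multiplier_map[OF \<beta>.group_hom_axioms \<pi>'.normal_kernel \<pi>.normal_kernel \<beta>R] by blast
  have "?K #>\<^bsub>F\<^esub> (\<beta> \<circ> \<alpha>) x = ?K #>\<^bsub>F\<^esub> x" if "x \<in> ?A" for x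
  proof (rule \<pi>.G.hom_cong_iter_comm[OF \<pi>.normal_kernel])
    show "\<beta> \<circ> \<alpha> \<in> hom F F" using \<alpha>(1) \<beta>(1) by (rule hom_compose)
    show "?R #>\<^bsub>F\<^esub> (\<beta> \<circ> \<alpha>) f = ?R #>\<^bsub>F\<^esub> f" if "f \<in> carrier F" for f
      using that \<alpha>(2) \<beta>(2) by (subst \<pi>.G.coset_eq_iff[OF \<pi>.normal_kernel]) (auto simp: kernel_def)
  qed (use that in simp)
  then have gh: "g (h (?K #>\<^bsub>F\<^esub> x)) = ?K #>\<^bsub>F\<^esub> x" if "x \<in> ?A" for x using h(2) g(2) that by simp
  have "?K' #>\<^bsub>F'\<^esub> (\<alpha> \<circ> \<beta>) x = ?K' #>\<^bsub>F'\<^esub> x" if "x \<in> ?A'" for x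
  proof (rule \<pi>'.G.hom_cong_iter_comm[OF \<pi>'.normal_kernel])
    show "\<alpha> \<circ> \<beta> \<in> hom F' F'" using \<beta>(1) \<alpha>(1) by (rule hom_compose)
    show "?R' #>\<^bsub>F'\<^esub> (\<alpha> \<circ> \<beta>) f = ?R' #>\<^bsub>F'\<^esub> f" if "f \<in> carrier F'" for f
      using that \<alpha>(2) \<beta>(2) by (subst \<pi>'.G.coset_eq_iff[OF \<pi>'.normal_kernel]) (auto simp: kernel_def)
  qed (use that in simp)
  then have hg: "h (g (?K' #>\<^bsub>F'\<^esub> x)) = ?K' #>\<^bsub>F'\<^esub> x" if "x \<in> ?A'" for x using h(2) g(2) that by simp
  have car: "carrier (rel_multiplier c F ?R) = (\<lambda>x. ?K #>\<^bsub>F\<^esub> x) ` ?A"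
    "carrier (rel_multiplier c F' ?R') = (\<lambda>x. ?K' #>\<^bsub>F'\<^esub> x) ` ?A'"
    unfolding rel_multiplier_def \<pi>.G.subquot_carrier \<pi>'.G.subquot_carrier by simp_all
  have "bij_betw h (carrier (rel_multiplier c F ?R)) (carrier (rel_multiplier c F' ?R'))"
    by (rule bij_betw_byWitness[where f' = g]) (use gh hg h(2) g(2) in \<open>auto simp: car\<close>)
  then show ?thesis using h(1) by (auto simp: is_iso_def iso_def)
qed

lemma c_multiplier_independent:
  assumes "group H" "free_presentation Y \<rho> H"
    and "group_hom (free_group Q) H \<pi>" "\<pi> ` carrier (free_group Q) = carrier H"
  shows "c_multiplier c Q \<pi> H \<cong> c_multiplier c Y \<rho> H"
proof -
  interpret \<pi>: group_hom "free_group Q" H \<pi> by fact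
  have \<rho>: "group_hom (free_group Y) H \<rho>" "\<rho> ` carrier (free_group Y) = carrier H"
    using assms(1,2) group_free_group
    by (auto simp: free_presentation_def group_hom_def group_hom_axioms_def)
  obtain \<alpha> where "\<alpha> \<in> hom (free_group Q) (free_group Y)"
    "\<And>w. w \<in> carrier (free_group Q) \<Longrightarrow> \<rho> (\<alpha> w) = \<pi> w"
    using free_group_lift[OF \<rho>, of \<pi> Q] \<pi>.homh by blast
  moreover obtain \<beta> where "\<beta> \<in> hom (free_group Y) (free_group Q)"
    "\<And>w. w \<in> carrier (free_group Y) \<Longrightarrow> \<pi> (\<beta> w) = \<rho> w"
    using free_group_lift[OF assms(3,4), of \<rho> Y] group_hom.homh[OF \<rho>(1)] by blast
  ultimately show ?thesis
    unfolding c_multiplier_eq using assms(3) \<rho>(1) by (intro rel_multiplier_iso)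
qed

section \<open>Left-normed commutators\<close>

context group
begin

section \<open>The upper central series under commutation\<close>

lemma upper_central_normal: "upper_central G j \<lhd> G"
proof (induction j)
  case 0
  then show ?case by (simp add: normal_inv_iff triv_subgroup)
next
  case (Suc j)
  let ?Z = "upper_central G j"
  interpret Z: normal ?Z G by fact
  have "subgroup (upper_central G (Suc j)) G"
  proof
    fix x y assume "x \<in> upper_central G (Suc j)" "y \<in> upper_central G (Suc j)"
    then show "x \<otimes> y \<in> upper_central G (Suc j)"
      by (auto simp: gcomm_mult_left intro!: Z.m_closed normal_conj[OF Suc])
  next
    fix x assume "x \<in> upper_central G (Suc j)"
    then show "inv x \<in> upper_central G (Suc j)"
      by (auto simp: gcomm_inv_left intro!: normal_conj[OF Suc])
  qed auto
  moreover have "x \<otimes> h \<otimes> inv x \<in> upper_central G (Suc j)"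
    if x: "x \<in> carrier G" and h: "h \<in> upper_central G (Suc j)" for x h
  proof -
    have "gcomm G (x \<otimes> h \<otimes> inv x) z \<in> ?Z" if z: "z \<in> carrier G" for z
    proof -
      have "gcomm G (x \<otimes> h \<otimes> inv x) z = x \<otimes> gcomm G h (inv x \<otimes> z \<otimes> x) \<otimes> inv x"
        using x h z by (simp add: gcomm_def m_assoc inv_mult_group)
      then show ?thesis using x h z by (simp add: normal_conj[OF Suc])
    qed
    then show ?thesis using x h by simp
  qed
  ultimately show ?case by (simp only: normal_inv_iff) blast
qed

text \<open>Each commutation with the whole group lowers the index by one; the case
  \<open>j = 0\<close> is the one used later.\<close>

lemma iter_comm_upper_central:
  "iter_comm G (upper_central G (i + j)) (carrier G) i \<subseteq> upper_central G j"
proof (induction i arbitrary: j)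
  case (Suc i)
  have "gcomm G u v \<in> upper_central G j"
    if "u \<in> iter_comm G (upper_central G (Suc i + j)) (carrier G) i" "v \<in> carrier G" for u v
    using Suc[of "Suc j"] that by auto
  then show ?case
    unfolding iter_comm.simps
    using upper_central_normal normal_imp_subgroup by (intro comm_subgroup_least) blast+
qed simp

text \<open>The index is shifted: \<open>gam k\<close> is \<open>\<gamma>\<^sub>k\<^sub>+\<^sub>1(G)\<close>.\<close>

abbreviation (input) gam :: "nat \<Rightarrow> 'a set" where
  "gam \<equiv> iter_comm G (carrier G) (carrier G)"

lemma gam_normal: "gam k \<lhd> G"
  by (intro iter_comm_normal normal_carrier)

lemma gam_gcomm: "x \<in> gam k \<Longrightarrow> f \<in> carrier G \<Longrightarrow> gcomm G x f \<in> gam (Suc k)"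
  by (rule gcomm_Suc_iter_comm)

lemma gam_Suc_subset: "gam (Suc k) \<subseteq> gam k"
  by (rule iter_comm_Suc_subset[OF normal_carrier])

lemma gam_carrier: "x \<in> gam k \<Longrightarrow> x \<in> carrier G"
  using gam_normal normal_mem_carrier by blast

end

definition lcomm :: "('a, 'm) monoid_scheme \<Rightarrow> 'a \<Rightarrow> 'a list \<Rightarrow> 'a" where
  "lcomm G = foldl (gcomm G)"

lemma lcomm_simps [simp]:
  "lcomm G x [] = x" "lcomm G x (f # fs) = lcomm G (gcomm G x f) fs"
  "lcomm G x (fs @ [f]) = gcomm G (lcomm G x fs) f"
  by (simp_all add: lcomm_def)

context group
begin

lemma lcomm_in_gam:
  "x \<in> gam k \<Longrightarrow> set fs \<subseteq> carrier G \<Longrightarrow> lcomm G x fs \<in> gam (k + length fs)"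
proof (induction fs arbitrary: x k)
  case (Cons f fs)
  then show ?case using Cons.IH[of "gcomm G x f" "Suc k"] gam_gcomm[of x k f] by simp
qed simp

text \<open>Modulo the next term of the lower central series, commutation is additive in its left
  entry, so left-normed commutators generate. The second assumption on \<open>J\<close> expresses
  working modulo that term.\<close>

lemma gam_generated_by_lcomm:
  assumes "subgroup J G" "gam (Suc (k + i)) \<subseteq> J"
    and "\<And>x fs. x \<in> gam k \<Longrightarrow> length fs = i \<Longrightarrow> set fs \<subseteq> carrier G \<Longrightarrow> lcomm G x fs \<in> J"
  shows "gam (k + i) \<subseteq> J"
  using assms
proof (induction i arbitrary: J)
  case 0
  then show ?case by force
next
  case (Suc i)
  let ?C = "carrier G"
  interpret J: subgroup J G by fact
  interpret X: normal "gam (k + i)" G by (rule gam_normal)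
  \<comment> \<open>The induction hypothesis is applied to this subgroup; the fact
    \<open>top\<close> supplies the correction terms that make it closed under products.\<close>
  define J' where "J' = {x \<in> gam (k + i). \<forall>f \<in> ?C. gcomm G x f \<in> J}"
  have top: "gcomm G (gcomm G x f) y \<in> J" if "x \<in> gam (k + i)" "f \<in> ?C" "y \<in> ?C" for x f y
    using gam_gcomm[OF gam_gcomm[OF that(1,2)] that(3)] Suc.prems(2) by auto
  have "subgroup J' G"
  proof
    show "J' \<subseteq> ?C" using X.subset by (auto simp: J'_def)
    show "\<one> \<in> J'" by (auto simp: J'_def X.one_closed)
  next
    fix x y assume xy: "x \<in> J'" "y \<in> J'"
    then have c: "x \<in> ?C" "y \<in> ?C" by (auto simp: J'_def)
    have "gcomm G (x \<otimes> y) f \<in> J" if f: "f \<in> ?C" for f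
    proof -
      have "gcomm G (x \<otimes> y) f = gcomm G x f \<otimes> gcomm G (gcomm G x f) y \<otimes> gcomm G y f"
        using c f by (simp add: gcomm_mult_left gcomm_def[of G "gcomm G x f"] m_assoc)
      then show ?thesis using xy f c top[of x f y] by (auto simp: J'_def)
    qed
    then show "x \<otimes> y \<in> J'" using xy by (auto simp: J'_def)
  next
    fix x assume x: "x \<in> J'"
    then have c: "x \<in> ?C" by (auto simp: J'_def)
    have "gcomm G (inv x) f \<in> J" if f: "f \<in> ?C" for f
    proof -
      let ?a = "gcomm G x f"
      have "gcomm G (inv x) f = inv ?a \<otimes> gcomm G (inv ?a) (inv x)"
        using c f by (simp add: gcomm_inv_left gcomm_def[of G "inv ?a"] m_assoc)
      moreover have "inv ?a \<in> gam (Suc (k + i))"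
        using x f gam_gcomm[of x "k + i" f] gam_normal normal_imp_subgroup subgroup.m_inv_closed
        unfolding J'_def by (metis (no_types, lifting) mem_Collect_eq)
      then have "gcomm G (inv ?a) (inv x) \<in> J"
        using gam_gcomm[of "inv ?a" "Suc (k + i)" "inv x"] c Suc.prems(2) by auto
      ultimately show ?thesis using x f by (auto simp: J'_def)
    qed
    then show "inv x \<in> J'" using x by (auto simp: J'_def)
  qed
  moreover have "gam (Suc (k + i)) \<subseteq> J'"
    using gam_Suc_subset[of "k + i"] gam_gcomm[of _ "Suc (k + i)"] Suc.prems(2)
    unfolding J'_def by auto
  moreover have "lcomm G x fs \<in> J'"
    if "x \<in> gam k" "length fs = i" "set fs \<subseteq> ?C" for x fs
    unfolding J'_def using that lcomm_in_gam[of x k fs] Suc.prems(3)[of x "fs @ [_]"] by auto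
  ultimately have "gam (k + i) \<subseteq> J'" by (rule Suc.IH)
  then have "gam (Suc (k + i)) \<subseteq> J"
    unfolding iter_comm.simps by (intro comm_subgroup_least Suc.prems(1)) (auto simp: J'_def)
  then show ?case by simp
qed

end

text \<open>The class of \<open>G\<close> is bounded by \<open>t\<close> and \<open>F\<close> is any
  group mapping onto \<open>G\<close>; in this form the setting also serves the induction for finite
  generation.\<close>

locale nilpotent_ext = group_hom F G \<pi>
  for F (structure) and G (structure) and \<pi> +
  fixes c t :: nat
  assumes surj: "\<pi> ` carrier F = carrier G"
    and c_pos: "c \<ge> 1" and t_pos: "t \<ge> 1"
    and nilp: "lcs G (carrier G) (t + 1) = {\<one>\<^bsub>G\<^esub>}"
begin

abbreviation "CF \<equiv> carrier F"

text \<open>\<open>U i\<close> is \<open>\<gamma>\<^sub>t\<^sub>+\<^sub>i(F)\<close>; taking one more commutator turns a congruence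
  modulo \<open>K i\<close> between elements of \<open>U i\<close> into one modulo \<open>K (Suc i)\<close>.\<close>

definition R where "R = kernel F G \<pi>"
definition U where "U i = iter_comm F CF CF (t - 1 + i)"
definition K where "K i = iter_comm F R CF i"
definition Z where "Z = upper_central G (t - 1)"
definition W where "W = {w \<in> CF. \<pi> w \<in> Z}"

lemma R_normal: "R \<lhd> F"
  unfolding R_def by (rule normal_kernel)

lemma K_normal: "K i \<lhd> F"
  unfolding K_def using R_normal by (intro G.iter_comm_normal G.normal_carrier)

lemma Z_normal: "Z \<lhd> G"
  unfolding Z_def by (rule H.upper_central_normal)

lemma W_normal: "W \<lhd> F"
proof -
  interpret Z: normal Z G by (rule Z_normal)
  show ?thesis
  proof (subst G.normal_inv_iff, intro conjI ballI)
    show "subgroup W F" by unfold_locales (auto simp: W_def)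
    fix x h assume "x \<in> CF" "h \<in> W"
    then show "x \<otimes>\<^bsub>F\<^esub> h \<otimes>\<^bsub>F\<^esub> inv\<^bsub>F\<^esub> x \<in> W" by (auto simp: W_def Z.inv_op_closed2)
  qed
qed

lemma U_carrier: "x \<in> U i \<Longrightarrow> x \<in> CF"
  unfolding U_def by (rule G.gam_carrier)

lemma U_normal: "U i \<lhd> F"
  unfolding U_def by (rule G.gam_normal)

lemma U_gcomm: "x \<in> U i \<Longrightarrow> f \<in> CF \<Longrightarrow> gcomm F x f \<in> U (Suc i)"
  unfolding U_def using G.gam_gcomm by simp

lemma K_gcomm: "x \<in> K i \<Longrightarrow> f \<in> CF \<Longrightarrow> gcomm F x f \<in> K (Suc i)"
  unfolding K_def by (rule G.gcomm_Suc_iter_comm)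

lemma image_gam: "\<pi> ` iter_comm F CF CF k = iter_comm G (carrier G) (carrier G) k"
  using image_iter_comm[OF group_hom_axioms subset_refl subset_refl] by (simp add: surj)

lemma image_U0: "\<pi> ` U 0 = lcs G (carrier G) t"
  unfolding U_def using image_gam[of "t - 1"] by (simp add: lcs_def)

text \<open>As \<open>\<gamma>\<^sub>t\<^sub>+\<^sub>1(G)\<close> is trivial,
  \<open>\<gamma>\<^sub>t\<^sub>+\<^sub>1(F)\<close> lies in \<open>R\<close>; then commute
  \<open>i\<close> times with \<open>F\<close>. This removes the error terms of
  multilinearity.\<close>

lemma U_Suc_subset_K: "U (Suc i) \<subseteq> K i"
proof -
  have "\<pi> ` iter_comm F CF CF t = {\<one>\<^bsub>G\<^esub>}" using image_gam[of t] nilp by simp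
  then have "iter_comm F CF CF t \<subseteq> R"
    unfolding R_def kernel_def using G.gam_carrier by blast
  then have "iter_comm F (iter_comm F CF CF t) CF i \<subseteq> K i"
    unfolding K_def by (rule G.iter_comm_mono)
  then show ?thesis unfolding U_def G.iter_comm_add using t_pos by simp
qed

text \<open>Since \<open>[Z\<^sub>t\<^sub>-\<^sub>1(G),\<^sub>t\<^sub>-\<^sub>1G]\<close> is
  trivial, \<open>[W,\<^sub>t\<^sub>-\<^sub>1F]\<close> lies in \<open>R\<close>. The three subgroup
  lemma puts the commutator into \<open>[W,\<^sub>t\<^sub>+\<^sub>iF]\<close>, hence into
  \<open>[R,\<^sub>i\<^sub>+\<^sub>1F]\<close>.\<close>

lemma W_gcomm: 
  assumes "x \<in> U i" "w \<in> W"
  shows "gcomm F x w \<in> K (Suc i)"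
proof -
  have "\<pi> ` W = Z"
    using surj subgroup.subset[OF normal_imp_subgroup[OF Z_normal]] by (auto simp: W_def)
  then have "\<pi> ` iter_comm F W CF (t - 1) = iter_comm G Z (carrier G) (t - 1)"
    using image_iter_comm[OF group_hom_axioms, of W CF] surj by (simp add: W_def)
  also have "\<dots> \<subseteq> {\<one>\<^bsub>G\<^esub>}"
    using H.iter_comm_upper_central[of "t - 1" 0] by (simp add: Z_def)
  finally have "iter_comm F W CF (t - 1) \<subseteq> R"
    using G.normal_mem_carrier[OF G.iter_comm_normal[OF W_normal G.normal_carrier]]
    unfolding R_def kernel_def by blast
  then have "iter_comm F (iter_comm F W CF (t - 1)) CF (Suc i) \<subseteq> K (Suc i)"
    unfolding K_def by (rule G.iter_comm_mono)
  moreover have "gcomm F x w \<in> iter_comm F W CF (Suc (t - 1 + i))"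
    using G.gcomm_iter_comm'[OF W_normal assms(2)] assms(1) unfolding U_def by simp
  ultimately show ?thesis unfolding G.iter_comm_add by auto
qed

lemma U_gcomm_gcomm: "x \<in> U i \<Longrightarrow> f \<in> CF \<Longrightarrow> g \<in> CF \<Longrightarrow> gcomm F (gcomm F x f) g \<in> K (Suc i)"
  using U_gcomm U_Suc_subset_K by blast

lemma gcomm_cong:
  assumes x: "x \<in> U i" "y \<in> U i" "K i #>\<^bsub>F\<^esub> x = K i #>\<^bsub>F\<^esub> y"
    and f: "f \<in> CF" "g \<in> CF" "W #>\<^bsub>F\<^esub> f = W #>\<^bsub>F\<^esub> g"
  shows "K (Suc i) #>\<^bsub>F\<^esub> gcomm F x f = K (Suc i) #>\<^bsub>F\<^esub> gcomm F y g"
proof -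
  note c = x(1,2)[THEN U_carrier]
  obtain n where n: "n \<in> K i" "y = n \<otimes>\<^bsub>F\<^esub> x" using G.coset_eqE[OF K_normal c x(3)] .
  obtain w where w: "w \<in> W" "g = w \<otimes>\<^bsub>F\<^esub> f" using G.coset_eqE[OF W_normal f] .
  show ?thesis unfolding n(2) w(2)
  proof (rule G.gcomm_coset_cong[OF K_normal, symmetric])
    show "n \<in> CF" "w \<in> CF"
      using n(1) w(1) K_normal W_normal G.normal_mem_carrier by blast+
    show "gcomm F n h \<in> K (Suc i)" if "h \<in> CF" for h using n(1) that by (rule K_gcomm)
    show "gcomm F x w \<in> K (Suc i)" using x(1) w(1) by (rule W_gcomm)
  qed (use c f in auto)
qed

lemma lcomm_U: "x \<in> U i \<Longrightarrow> set fs \<subseteq> CF \<Longrightarrow> lcomm F x fs \<in> U (i + length fs)"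
  unfolding U_def using G.lcomm_in_gam[of x "t - 1 + i" fs] by (simp add: add.assoc)

lemma lcomm_carrier: "x \<in> U i \<Longrightarrow> set fs \<subseteq> CF \<Longrightarrow> lcomm F x fs \<in> CF"
  using lcomm_U U_carrier by blast

definition W_cong where
  "W_cong f g \<longleftrightarrow> f \<in> CF \<and> g \<in> CF \<and> W #>\<^bsub>F\<^esub> f = W #>\<^bsub>F\<^esub> g"

text \<open>Entry by entry from \<open>gcomm_cong\<close>, the modulus advancing with each
  commutation. This makes the choice of lifts irrelevant for the map out of the tensor
  power.\<close>

lemma lcomm_cong:
  assumes "list_all2 W_cong fs gs" "x \<in> U i" "y \<in> U i" "K i #>\<^bsub>F\<^esub> x = K i #>\<^bsub>F\<^esub> y"
  shows "K (i + length fs) #>\<^bsub>F\<^esub> lcomm F x fs = K (i + length fs) #>\<^bsub>F\<^esub> lcomm F y gs"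
  using assms
proof (induction arbitrary: i x y rule: list_all2_induct)
  case (Cons f fs g gs)
  then show ?case
    using Cons.IH[of "gcomm F x f" "Suc i" "gcomm F y g"] gcomm_cong[of x i y f g]
      U_gcomm[of x i f] U_gcomm[of y i g]
    by (simp add: W_cong_def)
qed simp

lemma W_cong_refl: "set fs \<subseteq> CF \<Longrightarrow> list_all2 W_cong fs fs"
  by (auto simp: W_cong_def list_all2_same)

text \<open>The first commutation is additive modulo \<open>K (Suc i)\<close>, and
  \<open>lcomm_cong\<close> carries that congruence through the remaining entries.\<close>

lemma lcomm_mult_left:
  assumes "x \<in> U i" "y \<in> U i" "set fs \<subseteq> CF"
  shows "K (i + length fs) #>\<^bsub>F\<^esub> lcomm F (x \<otimes>\<^bsub>F\<^esub> y) fs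
       = K (i + length fs) #>\<^bsub>F\<^esub> (lcomm F x fs \<otimes>\<^bsub>F\<^esub> lcomm F y fs)"
  using assms
proof (induction fs arbitrary: x y i)
  case (Cons f fs)
  have f: "f \<in> CF" and fs: "set fs \<subseteq> CF" using Cons.prems by auto
  note c = Cons.prems(1,2)[THEN U_carrier]
  interpret Xi: normal "U i" F by (rule U_normal)
  interpret Xs: normal "U (Suc i)" F by (rule U_normal)
  have U: "gcomm F x f \<in> U (Suc i)" "gcomm F y f \<in> U (Suc i)" "gcomm F (x \<otimes>\<^bsub>F\<^esub> y) f \<in> U (Suc i)"
    using Cons.prems f by (auto intro!: U_gcomm)
  have "K (Suc i) #>\<^bsub>F\<^esub> gcomm F (x \<otimes>\<^bsub>F\<^esub> y) f = K (Suc i) #>\<^bsub>F\<^esub> (gcomm F x f \<otimes>\<^bsub>F\<^esub> gcomm F y f)"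
    using c f U_gcomm_gcomm[OF Cons.prems(1) f c(2)] by (intro G.gcomm_coset_mult_left K_normal)
  then have "K (Suc i + length fs) #>\<^bsub>F\<^esub> lcomm F (gcomm F (x \<otimes>\<^bsub>F\<^esub> y) f) fs
      = K (Suc i + length fs) #>\<^bsub>F\<^esub> lcomm F (gcomm F x f \<otimes>\<^bsub>F\<^esub> gcomm F y f) fs"
    using U by (intro lcomm_cong W_cong_refl fs) auto
  then show ?case using Cons.IH[OF U(1,2) fs] by simp
qed simp

text \<open>At position \<open>j\<close> the commutator is additive in its right entry; the product
  so obtained becomes a left entry and is split further by \<open>lcomm_mult_left\<close>.\<close>

lemma lcomm_mult_nth:
  assumes "x \<in> U i" "set fs \<subseteq> CF" "j < length fs" "f \<in> CF" "g \<in> CF"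
  shows "K (i + length fs) #>\<^bsub>F\<^esub> lcomm F x (fs[j := f \<otimes>\<^bsub>F\<^esub> g])
       = K (i + length fs) #>\<^bsub>F\<^esub> (lcomm F x (fs[j := f]) \<otimes>\<^bsub>F\<^esub> lcomm F x (fs[j := g]))"
  using assms
proof (induction fs arbitrary: x i j)
  case (Cons h fs)
  note c = U_carrier[OF Cons.prems(1)]
  have h: "h \<in> CF" and fs: "set fs \<subseteq> CF" using Cons.prems by auto
  interpret Xs: normal "U (Suc i)" F by (rule U_normal)
  show ?case
  proof (cases j)
    case 0
    have fg: "f \<in> CF" "g \<in> CF" using Cons.prems by auto
    have U: "gcomm F x f \<in> U (Suc i)" "gcomm F x g \<in> U (Suc i)" "gcomm F x (f \<otimes>\<^bsub>F\<^esub> g) \<in> U (Suc i)"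
      using Cons.prems by (auto intro!: U_gcomm)
    have "K (Suc i) #>\<^bsub>F\<^esub> gcomm F x (f \<otimes>\<^bsub>F\<^esub> g) = K (Suc i) #>\<^bsub>F\<^esub> (gcomm F x f \<otimes>\<^bsub>F\<^esub> gcomm F x g)"
      using c fg U_gcomm_gcomm[OF Cons.prems(1) fg(1)] by (intro G.gcomm_coset_mult_right K_normal)
    then have "K (Suc i + length fs) #>\<^bsub>F\<^esub> lcomm F (gcomm F x (f \<otimes>\<^bsub>F\<^esub> g)) fs
      = K (Suc i + length fs) #>\<^bsub>F\<^esub> lcomm F (gcomm F x f \<otimes>\<^bsub>F\<^esub> gcomm F x g) fs"
      using U by (intro lcomm_cong W_cong_refl fs) auto
    then show ?thesis using lcomm_mult_left[OF U(1,2) fs] 0 by simp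
  next
    case (Suc j')
    then show ?thesis
      using Cons.IH[OF U_gcomm[OF Cons.prems(1) h] fs, of j'] Cons.prems by simp
  qed
qed simp

end

section \<open>Tensor powers\<close>

lemma tensor_rels_carrier:
  assumes "group B" "group A"
  shows "tensor_rels B A c \<subseteq> carrier (free_Abelian_group (tensor_gens B A c))"
proof -
  interpret B: group B by fact
  interpret A: group A by fact
  let ?FA = "free_Abelian_group (tensor_gens B A c)"
  have diff: "x - y - z \<in> carrier ?FA"
    if "x \<in> carrier ?FA" "y \<in> carrier ?FA" "z \<in> carrier ?FA" for x y z
    using that keys_diff[of "x - y" z] keys_diff[of x y]
    unfolding carrier_free_Abelian_group_iff by blast
  have sing: "Poly_Mapping.single p (1::int) \<in> carrier ?FA" if "p \<in> tensor_gens B A c" for p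
    using that by simp
  have upd: "set (as[i := a]) \<subseteq> carrier A" if "set as \<subseteq> carrier A" "a \<in> carrier A" for as i a
    using that set_update_subset_insert[of as i a] by auto
  show ?thesis
  proof
    fix x assume "x \<in> tensor_rels B A c"
    then show "x \<in> carrier ?FA"
      unfolding tensor_rels_def
      by (elim UnE CollectE exE conjE) (simp_all only:, (intro diff sing; simp add: tensor_gens_def upd)+)
  qed
qed

lemma comm_group_tensor_power:
  assumes "group B" "group A"
  shows "comm_group (tensor_power c B A)"
  unfolding tensor_power_def Let_def
  using group.generate_is_subgroup[OF group_free_Abelian_group tensor_rels_carrier[OF assms]]
  by (rule comm_group.abelian_FactGroup[OF abelian_free_Abelian_group])

text \<open>The universal property of the tensor power. On pure tensors it records only that the
  values of \<open>\<theta>\<close> are attained, which is the form the surjectivity argument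
  uses.\<close>

lemma tensor_power_lift:
  assumes "comm_group M" "group B" "group A"
    and \<theta>: "\<And>b as. b \<in> carrier B \<Longrightarrow> length as = c \<Longrightarrow> set as \<subseteq> carrier A \<Longrightarrow> \<theta> (b, as) \<in> carrier M"
    and left: "\<And>b b' as. b \<in> carrier B \<Longrightarrow> b' \<in> carrier B \<Longrightarrow> length as = c \<Longrightarrow> set as \<subseteq> carrier A
      \<Longrightarrow> \<theta> (b \<otimes>\<^bsub>B\<^esub> b', as) = \<theta> (b, as) \<otimes>\<^bsub>M\<^esub> \<theta> (b', as)"
    and nth: "\<And>b as i a a'. b \<in> carrier B \<Longrightarrow> length as = c \<Longrightarrow> set as \<subseteq> carrier A \<Longrightarrow> i < c
      \<Longrightarrow> a \<in> carrier A \<Longrightarrow> a' \<in> carrier A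
      \<Longrightarrow> \<theta> (b, as[i := a \<otimes>\<^bsub>A\<^esub> a']) = \<theta> (b, as[i := a]) \<otimes>\<^bsub>M\<^esub> \<theta> (b, as[i := a'])"
  obtains h where "h \<in> hom (tensor_power c B A) M"
    "\<theta> ` tensor_gens B A c \<subseteq> h ` carrier (tensor_power c B A)"
proof -
  interpret M: comm_group M by fact
  interpret B: group B by fact
  interpret A: group A by fact
  let ?S = "tensor_gens B A c"
  let ?FA = "free_Abelian_group ?S"
  interpret FA: comm_group ?FA by (rule abelian_free_Abelian_group)
  have \<theta>S: "\<theta> ` ?S \<subseteq> carrier M" using \<theta> by (auto simp: tensor_gens_def)
  obtain k where k: "k \<in> hom ?FA M" "\<And>p. p \<in> ?S \<Longrightarrow> k (frag_of p) = \<theta> p"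
    using M.free_Abelian_group_universal[OF \<theta>S] by blast
  interpret k: group_hom ?FA M k using k(1) by unfold_locales
  let ?N = "generate ?FA (tensor_rels B A c)"
  note rels = tensor_rels_carrier[OF \<open>group B\<close> \<open>group A\<close>, of c]
  have N: "?N \<lhd> ?FA"
    using FA.generate_is_subgroup[OF rels] FA.normal_iff_subgroup by blast
  have rel: "k (frag_of p - frag_of q - frag_of r) = \<one>\<^bsub>M\<^esub>"
    if "p \<in> ?S" "q \<in> ?S" "r \<in> ?S" "\<theta> p = \<theta> q \<otimes>\<^bsub>M\<^esub> \<theta> r" for p q r
  proof -
    \<comment> \<open>Subtraction is written with the operations of the free abelian group so that
      \<open>k\<close> distributes over it; the simp rules converting back are then switched
      off.\<close>
    have e: "frag_of p - frag_of q - frag_of r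
        = frag_of p \<otimes>\<^bsub>?FA\<^esub> (inv\<^bsub>?FA\<^esub> (frag_of q) \<otimes>\<^bsub>?FA\<^esub> inv\<^bsub>?FA\<^esub> (frag_of r))"
      using that by simp
    have c: "frag_of p \<in> carrier ?FA" "frag_of q \<in> carrier ?FA" "frag_of r \<in> carrier ?FA"
      using that by simp_all
    have "k (frag_of p - frag_of q - frag_of r) = \<theta> p \<otimes>\<^bsub>M\<^esub> (inv\<^bsub>M\<^esub> (\<theta> q) \<otimes>\<^bsub>M\<^esub> inv\<^bsub>M\<^esub> (\<theta> r))"
      unfolding e using c that
      by (simp add: k(2) del: mult_free_Abelian_group inv_free_Abelian_group carrier_free_Abelian_group_iff)
    also have "\<dots> = \<one>\<^bsub>M\<^esub>"
    proof -
      have "\<theta> p \<in> carrier M" "\<theta> q \<in> carrier M" "\<theta> r \<in> carrier M" using that \<theta>S by auto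
      then show ?thesis using that(4) by (simp add: M.m_ac)
    qed
    finally show ?thesis .
  qed
  have upd: "set (as[i := a]) \<subseteq> carrier A" if "set as \<subseteq> carrier A" "a \<in> carrier A" for as i a
    using that set_update_subset_insert[of as i a] by auto
  have "tensor_rels B A c \<subseteq> kernel ?FA M k"
  proof
    fix x assume x: "x \<in> tensor_rels B A c"
    then have "\<exists>p q r. p \<in> ?S \<and> q \<in> ?S \<and> r \<in> ?S \<and> \<theta> p = \<theta> q \<otimes>\<^bsub>M\<^esub> \<theta> r
        \<and> x = frag_of p - frag_of q - frag_of r"
      unfolding tensor_rels_def
    proof (elim UnE CollectE exE conjE)
      fix b1 b2 as
      assume "x = Poly_Mapping.single (b1 \<otimes>\<^bsub>B\<^esub> b2, as) 1 - Poly_Mapping.single (b1, as) 1 - Poly_Mapping.single (b2, as) 1"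
        "b1 \<in> carrier B" "b2 \<in> carrier B" "length as = c" "set as \<subseteq> carrier A"
      then show ?thesis
        by (intro exI[of _ "(b1 \<otimes>\<^bsub>B\<^esub> b2, as)"] exI[of _ "(b1, as)"] exI[of _ "(b2, as)"])
          (simp add: left tensor_gens_def)
    next
      fix b as i a1 a2
      assume "x = Poly_Mapping.single (b, as[i := a1 \<otimes>\<^bsub>A\<^esub> a2]) 1 - Poly_Mapping.single (b, as[i := a1]) 1
            - Poly_Mapping.single (b, as[i := a2]) 1"
        "b \<in> carrier B" "length as = c" "set as \<subseteq> carrier A" "i < c"
        "a1 \<in> carrier A" "a2 \<in> carrier A"
      then show ?thesis
        by (intro exI[of _ "(b, as[i := a1 \<otimes>\<^bsub>A\<^esub> a2])"] exI[of _ "(b, as[i := a1])"] exI[of _ "(b, as[i := a2])"])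
          (simp add: nth tensor_gens_def upd)
    qed
    then have "k x = \<one>\<^bsub>M\<^esub>" using rel by blast
    then show "x \<in> kernel ?FA M k" using subsetD[OF rels x] by (simp add: kernel_def)
  qed
  then have "?N \<subseteq> kernel ?FA M k" by (rule FA.generate_subgroup_incl[OF _ k.subgroup_kernel])
  then obtain h where h: "h \<in> hom (?FA Mod ?N) M" "\<And>x. x \<in> carrier ?FA \<Longrightarrow> h (?N #>\<^bsub>?FA\<^esub> x) = k x"
    using k.FactGroup_universal_kernel[OF N] by blast
  have "\<theta> p \<in> h ` carrier (?FA Mod ?N)" if "p \<in> ?S" for p
  proof -
    have "frag_of p \<in> carrier ?FA" using that by simp
    then have "\<theta> p = h (?N #>\<^bsub>?FA\<^esub> frag_of p)" "?N #>\<^bsub>?FA\<^esub> frag_of p \<in> carrier (?FA Mod ?N)"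
      using h(2) k(2)[OF that] unfolding carrier_FactGroup by auto
    then show ?thesis by blast
  qed
  then have "\<theta> ` ?S \<subseteq> h ` carrier (?FA Mod ?N)" by blast
  then show thesis using that h(1) by (simp add: tensor_power_def Let_def)
qed

section \<open>Finite generation of tensor powers\<close>

lemma gen_by_free_Abelian_group:
  assumes "finite S"
  shows "gen_by (free_Abelian_group S) (card S)"
proof -
  let ?FA = "free_Abelian_group S"
  interpret FA: comm_group ?FA by (rule abelian_free_Abelian_group)
  have sub: "frag_of ` S \<subseteq> carrier ?FA" by auto
  interpret D: subgroup "generate ?FA (frag_of ` S)" ?FA by (rule FA.generate_is_subgroup[OF sub])
  have "x \<in> generate ?FA (frag_of ` S)" if "x \<in> carrier ?FA" for x
  proof -
    have "Poly_Mapping.keys x \<subseteq> S" using that by simp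
    then show ?thesis
    proof (induction rule: frag_induction)
      case zero
      then show ?case using D.one_closed by simp
    next
      case (one x)
      then show ?case by (auto intro: generate.incl)
    next
      case (diff a b)
      then have "a \<otimes>\<^bsub>?FA\<^esub> inv\<^bsub>?FA\<^esub> b \<in> generate ?FA (frag_of ` S)"
        by (intro D.m_closed D.m_inv_closed)
      then show ?case using D.mem_carrier[OF diff(2)] by simp
    qed
  qed
  then have "generate ?FA (frag_of ` S) = carrier ?FA" using D.subset by blast
  then show ?thesis
    unfolding gen_by_def using assms sub card_image_le[OF assms, of frag_of] by blast
qed

lemma gen_by_tensor_power:
  assumes "group B" "group A" "finite (carrier B)" "finite (carrier A)"
  shows "gen_by (tensor_power c B A) (card (tensor_gens B A c))"
proof -
  let ?FA = "free_Abelian_group (tensor_gens B A c)"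
  let ?N = "generate ?FA (tensor_rels B A c)"
  interpret FA: comm_group ?FA by (rule abelian_free_Abelian_group)
  have N: "?N \<lhd> ?FA"
    using FA.generate_is_subgroup[OF tensor_rels_carrier[OF assms(1,2)]] FA.normal_iff_subgroup by blast
  interpret q: group_hom ?FA "tensor_power c B A" "\<lambda>x. ?N #>\<^bsub>?FA\<^esub> x"
    unfolding tensor_power_def Let_def group_hom_def group_hom_axioms_def
    using FA.is_group normal.r_coset_hom_Mod[OF N] normal.factorgroup_is_group[OF N] by blast
  have "finite (tensor_gens B A c)"
    using assms(3,4) finite_lists_length_eq[OF assms(4), of c]
    by (simp add: tensor_gens_def conj_commute)
  then show ?thesis
    by (intro gen_by_hom[OF q.group_hom_axioms] gen_by_free_Abelian_group)
      (simp_all add: tensor_power_def Let_def carrier_FactGroup)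
qed

text \<open>The power of \<open>x\<close> by the exponent of \<open>B\<close> lies in the kernel,
  hence comes from \<open>T\<close> and is killed by the exponent of \<open>T\<close>.\<close>

lemma group_exponent_extension:
  assumes "group_hom A B f" "group_hom T (A\<lparr>carrier := kernel A B f\<rparr>) g"
    and "g ` carrier T = kernel A B f"
  shows "group_exponent A dvd group_exponent B * group_exponent T"
proof -
  interpret f: group_hom A B f by fact
  interpret g: group_hom T "A\<lparr>carrier := kernel A B f\<rparr>" g by fact
  show ?thesis
  proof (rule group_exponent_dvd[OF f.G.is_group])
    fix x assume x: "x \<in> carrier A"
    let ?y = "x [^]\<^bsub>A\<^esub> group_exponent B"
    have "f ?y = \<one>\<^bsub>B\<^esub>"
      using x pow_group_exponent[OF f.H.is_group f.hom_closed[OF x]] by (simp add: f.hom_nat_pow)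
    then have "?y \<in> g ` carrier T" using x assms(3) by (simp add: kernel_def)
    then obtain z where z: "z \<in> carrier T" "?y = g z" by blast
    have "?y [^]\<^bsub>A\<^esub> group_exponent T = g (z [^]\<^bsub>T\<^esub> group_exponent T)"
      using z by (simp add: g.hom_nat_pow flip: f.G.nat_pow_consistent)
    also have "\<dots> = \<one>\<^bsub>A\<^esub>"
      using z(1) g.hom_one by (simp add: pow_group_exponent[OF g.G.is_group])
    finally show "x [^]\<^bsub>A\<^esub> (group_exponent B * group_exponent T) = \<one>\<^bsub>A\<^esub>"
      using x by (simp add: f.G.nat_pow_pow)
  qed
qed

lemma group_exponent_inj:
  assumes "group_hom A B f" "inj_on f (carrier A)"
  shows "group_exponent A dvd group_exponent B"
proof -
  interpret f: group_hom A B f by fact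
  show ?thesis
  proof (rule group_exponent_dvd[OF f.G.is_group])
    fix x assume x: "x \<in> carrier A"
    have "f (x [^]\<^bsub>A\<^esub> group_exponent B) = f \<one>\<^bsub>A\<^esub>"
      using x pow_group_exponent[OF f.H.is_group f.hom_closed[OF x]] by (simp add: f.hom_nat_pow)
    then show "x [^]\<^bsub>A\<^esub> group_exponent B = \<one>\<^bsub>A\<^esub>"
      using x by (intro inj_onD[OF assms(2)]) auto
  qed
qed

section \<open>The exact sequence\<close>

context nilpotent_ext
begin

definition S where "S = {x \<in> CF. \<pi> x \<in> lcs G (carrier G) t}"
definition L where "L i = iter_comm F S CF i"

abbreviation "\<Gamma> \<equiv> lcs F CF (c + 1)"
abbreviation "tensor \<equiv> tensor_power c (G\<lparr>carrier := lcs G (carrier G) t\<rparr>) (G Mod Z)"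

text \<open>Identifies \<open>S\<close> as the relation subgroup for \<open>\<pi>\<close> followed
  by the projection onto \<open>G\<close> modulo \<open>\<gamma>\<^sub>t(G)\<close>, so that
  \<open>rel_multiplier c F S\<close> belongs to that quotient.\<close>

lemma S_eq_kernel:
  "S = kernel F (G Mod lcs G (carrier G) t) (\<lambda>x. lcs G (carrier G) t #>\<^bsub>G\<^esub> \<pi> x)"
proof -
  have "subgroup (lcs G (carrier G) t) G" using H.lcs_normal by (rule normal_imp_subgroup)
  then have "lcs G (carrier G) t #>\<^bsub>G\<^esub> y = lcs G (carrier G) t \<longleftrightarrow> y \<in> lcs G (carrier G) t"
    if "y \<in> carrier G" for y
    using that H.coset_join1 H.coset_join2 by metis
  then show ?thesis unfolding S_def kernel_def by (intro Collect_cong conj_cong refl) simp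
qed

lemma quotient_hom:
  "group_hom F (G Mod lcs G (carrier G) t) (\<lambda>x. lcs G (carrier G) t #>\<^bsub>G\<^esub> \<pi> x)"
  "(\<lambda>x. lcs G (carrier G) t #>\<^bsub>G\<^esub> \<pi> x) ` CF = carrier (G Mod lcs G (carrier G) t)"
proof -
  have "(\<lambda>x. lcs G (carrier G) t #>\<^bsub>G\<^esub> x) \<circ> \<pi> \<in> hom F (G Mod lcs G (carrier G) t)"
    using homh normal.r_coset_hom_Mod[OF H.lcs_normal] by (rule Group.hom_compose)
  then show "group_hom F (G Mod lcs G (carrier G) t) (\<lambda>x. lcs G (carrier G) t #>\<^bsub>G\<^esub> \<pi> x)"
    using normal.factorgroup_is_group[OF H.lcs_normal] G.is_group
    by (simp add: group_hom_def group_hom_axioms_def comp_def)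
  show "(\<lambda>x. lcs G (carrier G) t #>\<^bsub>G\<^esub> \<pi> x) ` CF = carrier (G Mod lcs G (carrier G) t)"
    by (simp add: carrier_FactGroup image_image flip: surj)
qed

lemma S_normal: "S \<lhd> F"
  unfolding S_eq_kernel by (rule group_hom.normal_kernel[OF quotient_hom(1)])

lemma R_subset_S: "R \<subseteq> S"
  using subgroup.one_closed[OF normal_imp_subgroup[OF H.lcs_normal]]
  by (auto simp: R_def S_def kernel_def)

lemma L_normal: "L i \<lhd> F"
  unfolding L_def using S_normal by (intro G.iter_comm_normal G.normal_carrier)

lemma K_subset_L: "K i \<subseteq> L i"
  unfolding K_def L_def using R_subset_S by (rule G.iter_comm_mono)

lemma U_subset_L: "U i \<subseteq> L i"
proof -
  have "U 0 \<subseteq> S" using image_U0 U_carrier unfolding S_def by blast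
  then have "iter_comm F (U 0) CF i \<subseteq> L i" unfolding L_def by (rule G.iter_comm_mono)
  then show ?thesis unfolding U_def G.iter_comm_add by simp
qed

text \<open>For \<open>i = 0\<close> this is \<open>S = \<gamma>\<^sub>t(F) R\<close>. In the step,
  replacing \<open>s\<close> by a congruent \<open>x\<close> in \<open>U i\<close> changes a
  generator \<open>[s, f]\<close> only modulo \<open>K (Suc i)\<close>.\<close>

lemma L_coset:
  assumes "s \<in> L i"
  shows "\<exists>x \<in> U i. K i #>\<^bsub>F\<^esub> s = K i #>\<^bsub>F\<^esub> x"
  using assms
proof (induction i arbitrary: s)
  case 0
  then have s: "s \<in> CF" "\<pi> s \<in> \<pi> ` U 0" by (auto simp: L_def S_def image_U0)
  then obtain x where x: "x \<in> U 0" "\<pi> s = \<pi> x" by blast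
  then have "s \<otimes>\<^bsub>F\<^esub> inv\<^bsub>F\<^esub> x \<in> K 0"
    using s U_carrier[OF x(1)] by (simp add: K_def R_def kernel_def)
  then show ?case
    using x s(1) U_carrier[OF x(1)] G.coset_eq_iff[OF K_normal] by blast
next
  case (Suc i)
  let ?K = "K (Suc i)"
  interpret K: normal ?K F by (rule K_normal)
  interpret U: normal "U (Suc i)" F by (rule U_normal)
  define D where "D = {s \<in> CF. \<exists>x \<in> U (Suc i). ?K #>\<^bsub>F\<^esub> s = ?K #>\<^bsub>F\<^esub> x}"
  have "subgroup D F"
  proof
    show "\<one>\<^bsub>F\<^esub> \<in> D" using U.one_closed by (auto simp: D_def)
  next
    fix s s' assume "s \<in> D" "s' \<in> D"
    then obtain x x' where *: "x \<in> U (Suc i)" "x' \<in> U (Suc i)" "s \<in> CF" "s' \<in> CF"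
      "?K #>\<^bsub>F\<^esub> s = ?K #>\<^bsub>F\<^esub> x" "?K #>\<^bsub>F\<^esub> s' = ?K #>\<^bsub>F\<^esub> x'" by (auto simp: D_def)
    then have "?K #>\<^bsub>F\<^esub> (s \<otimes>\<^bsub>F\<^esub> s') = ?K #>\<^bsub>F\<^esub> (x \<otimes>\<^bsub>F\<^esub> x')"
      by (simp add: U_carrier flip: K.rcos_sum)
    then show "s \<otimes>\<^bsub>F\<^esub> s' \<in> D" using * U.m_closed by (auto simp: D_def)
  next
    fix s assume "s \<in> D"
    then obtain x where *: "x \<in> U (Suc i)" "s \<in> CF" "?K #>\<^bsub>F\<^esub> s = ?K #>\<^bsub>F\<^esub> x" by (auto simp: D_def)
    then obtain n where n: "n \<in> ?K" "x = n \<otimes>\<^bsub>F\<^esub> s"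
      using G.coset_eqE[OF K_normal *(2) U_carrier *(3)] by blast
    then have "inv\<^bsub>F\<^esub> x = inv\<^bsub>F\<^esub> s \<otimes>\<^bsub>F\<^esub> inv\<^bsub>F\<^esub> n" using * by (simp add: G.inv_mult_group)
    then have "?K #>\<^bsub>F\<^esub> inv\<^bsub>F\<^esub> s = ?K #>\<^bsub>F\<^esub> inv\<^bsub>F\<^esub> x"
      using * n(1) by (simp add: G.coset_absorb[OF K_normal])
    then show "inv\<^bsub>F\<^esub> s \<in> D" using * U.m_inv_closed by (auto simp: D_def)
  qed (auto simp: D_def)
  moreover have "gcomm F s f \<in> D" if s: "s \<in> L i" and f: "f \<in> CF" for s f
  proof -
    obtain x where x: "x \<in> U i" "K i #>\<^bsub>F\<^esub> s = K i #>\<^bsub>F\<^esub> x" using Suc.IH[OF s] by blast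
    have sc: "s \<in> CF" using s L_normal G.normal_mem_carrier by blast
    obtain n where n: "n \<in> K i" "x = n \<otimes>\<^bsub>F\<^esub> s" using G.coset_eqE[OF K_normal sc U_carrier[OF x(1)] x(2)] .
    \<comment> \<open>Only the left entry changes, so the general congruence is used with trivial
      factor in the right entry.\<close>
    have "?K #>\<^bsub>F\<^esub> gcomm F (n \<otimes>\<^bsub>F\<^esub> s) (\<one>\<^bsub>F\<^esub> \<otimes>\<^bsub>F\<^esub> f) = ?K #>\<^bsub>F\<^esub> gcomm F s f"
      using n(1) sc f K_gcomm[OF n(1)] G.normal_mem_carrier[OF K_normal n(1)]
      by (intro G.gcomm_coset_cong[OF K_normal]) auto
    then show ?thesis
      using U_gcomm[OF x(1) f] sc f by (auto simp: D_def n(2)[symmetric])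
  qed
  ultimately have "L (Suc i) \<subseteq> D"
    unfolding L_def iter_comm.simps by (rule G.comm_subgroup_least) auto
  then show ?case using Suc.prems by (auto simp: D_def)
qed

text \<open>Modulo \<open>K c\<close> an element of \<open>L c\<close> lies in \<open>U c\<close>,
  and \<open>c \<ge> 1\<close> puts \<open>U c\<close> inside
  \<open>\<gamma>\<^sub>t\<^sub>+\<^sub>1(F)\<close>, hence in \<open>R\<close>. Thus all of
  \<open>L c\<close> modulo \<open>K c\<close> belongs to the multiplier of
  \<open>G\<close>.\<close>

lemma L_subset_R: "L c \<subseteq> R"
proof
  fix s assume s: "s \<in> L c"
  obtain x where x: "x \<in> U c" "K c #>\<^bsub>F\<^esub> s = K c #>\<^bsub>F\<^esub> x" using L_coset[OF s] by blast
  have K: "K i \<subseteq> R" for i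
    using G.iter_comm_antimono[OF R_normal, of 0 i] by (simp add: K_def)
  have sc: "s \<in> CF" using s L_normal G.normal_mem_carrier by blast
  interpret R: normal R F by (rule R_normal)
  have "x \<in> R" using x(1) c_pos U_Suc_subset_K[of "c - 1"] K by auto
  moreover have "s \<otimes>\<^bsub>F\<^esub> inv\<^bsub>F\<^esub> x \<in> R"
    using K x(2) G.coset_eq_iff[OF K_normal sc U_carrier[OF x(1)]] by blast
  ultimately have "s \<otimes>\<^bsub>F\<^esub> inv\<^bsub>F\<^esub> x \<otimes>\<^bsub>F\<^esub> x \<in> R" by simp
  then show "s \<in> R" using sc U_carrier[OF x(1)] by (simp add: G.m_assoc)
qed

lemma L_subset_\<Gamma>: "L c \<subseteq> \<Gamma>"
  using G.iter_comm_mono[of S CF CF c] by (auto simp: L_def S_def)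

lemma comm_group_L: "comm_group (F\<lparr>carrier := L c\<rparr> Mod K c)"
proof (rule G.subquot_comm[OF K_normal normal_imp_subgroup[OF L_normal] K_subset_L])
  fix x y assume "x \<in> L c" "y \<in> L c"
  then have "x \<in> R" "y \<in> iter_comm F CF CF c" using L_subset_R L_subset_\<Gamma> by auto
  then have "gcomm F x y \<in> K (Suc c)"
    unfolding K_def by (rule G.gcomm_iter_comm[OF R_normal])
  then show "gcomm F x y \<in> K c"
    using G.iter_comm_Suc_subset[OF R_normal] unfolding K_def by blast
qed

lemma group_tensor_factors:
  "group (G\<lparr>carrier := lcs G (carrier G) t\<rparr>)" "group (G Mod Z)"
  using H.subgroup_imp_group[OF normal_imp_subgroup[OF H.lcs_normal]]
    normal.factorgroup_is_group[OF Z_normal] by auto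

text \<open>The tensor \<open>b \<otimes> a\<^sub>1 \<otimes> \<dots> \<otimes> a\<^sub>c\<close> is sent to the left-normed commutator of arbitrary lifts,
  with \<open>b\<close> lifted to \<open>\<gamma>\<^sub>t(F)\<close>; modulo \<open>K c\<close> the choice of lifts is irrelevant.\<close>

lemma tensor_onto_L:
  obtains h where "group_hom tensor (F\<lparr>carrier := L c\<rparr> Mod K c) h"
    "h ` carrier tensor = carrier (F\<lparr>carrier := L c\<rparr> Mod K c)"
proof -
  let ?B = "G\<lparr>carrier := lcs G (carrier G) t\<rparr>" and ?A = "G Mod Z"
  let ?M = "F\<lparr>carrier := L c\<rparr> Mod K c"
  interpret Z: normal Z G by (rule Z_normal)
  interpret A: group ?A using group_tensor_factors by blast
  interpret K: normal "K c" F by (rule K_normal)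
  interpret U0: normal "U 0" F by (rule U_normal)
  interpret M: comm_group ?M by (rule comm_group_L)
  note LK = K_normal[of c] normal_imp_subgroup[OF L_normal[of c]] K_subset_L[of c]
  define u where "u b = (SOME x. x \<in> U 0 \<and> \<pi> x = b)" for b
  define r where "r a = (SOME f. f \<in> CF \<and> Z #>\<^bsub>G\<^esub> \<pi> f = a)" for a
  have u: "u b \<in> U 0" "\<pi> (u b) = b" if "b \<in> carrier ?B" for b
  proof -
    have "b \<in> \<pi> ` U 0" using that by (simp add: image_U0)
    then have "\<exists>x. x \<in> U 0 \<and> \<pi> x = b" by auto
    then have "u b \<in> U 0 \<and> \<pi> (u b) = b" unfolding u_def by (rule someI_ex)
    then show "u b \<in> U 0" "\<pi> (u b) = b" by auto
  qed
  have r: "r a \<in> CF" "Z #>\<^bsub>G\<^esub> \<pi> (r a) = a" if "a \<in> carrier ?A" for a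
  proof -
    have "\<exists>f. f \<in> CF \<and> Z #>\<^bsub>G\<^esub> \<pi> f = a" using that by (auto simp: carrier_FactGroup simp flip: surj)
    then have "r a \<in> CF \<and> Z #>\<^bsub>G\<^esub> \<pi> (r a) = a" unfolding r_def by (rule someI_ex)
    then show "r a \<in> CF" "Z #>\<^bsub>G\<^esub> \<pi> (r a) = a" by auto
  qed
  have u_cong: "K 0 #>\<^bsub>F\<^esub> x = K 0 #>\<^bsub>F\<^esub> y" if "x \<in> CF" "y \<in> CF" "\<pi> x = \<pi> y" for x y
    using that by (subst G.coset_eq_iff[OF K_normal]) (auto simp: K_def R_def kernel_def)
  have r_cong: "W_cong f g" if "f \<in> CF" "g \<in> CF" "Z #>\<^bsub>G\<^esub> \<pi> f = Z #>\<^bsub>G\<^esub> \<pi> g" for f g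
    unfolding W_cong_def using that
    by (simp add: G.coset_eq_iff[OF W_normal] H.coset_eq_iff[OF Z_normal]) (simp add: W_def)
  define \<theta> where "\<theta> = (\<lambda>(b, as). K c #>\<^bsub>F\<^esub> lcomm F (u b) (map r as))"
  have rs: "set (map r as) \<subseteq> CF" if "set as \<subseteq> carrier ?A" for as using that r by auto
  have mem: "lcomm F x fs \<in> U c" if "x \<in> U 0" "set fs \<subseteq> CF" "length fs = c" for x fs
    using lcomm_U[OF that(1,2)] that(3) by simp
  obtain h where h: "h \<in> hom tensor ?M" "\<theta> ` tensor_gens ?B ?A c \<subseteq> h ` carrier tensor"
  proof (rule tensor_power_lift[OF comm_group_L group_tensor_factors, where \<theta> = \<theta> and c = c])
    fix b as assume "b \<in> carrier ?B" "length as = c" "set as \<subseteq> carrier ?A"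
    then show "\<theta> (b, as) \<in> carrier ?M"
      using mem[OF u(1) rs, of b as] U_subset_L unfolding G.subquot_carrier by (auto simp: \<theta>_def)
  next
    fix b b' as
    assume b: "b \<in> carrier ?B" "b' \<in> carrier ?B" and as: "length as = c" "set as \<subseteq> carrier ?A"
    have bb: "b \<otimes>\<^bsub>?B\<^esub> b' \<in> carrier ?B"
      using b group.is_monoid[OF group_tensor_factors(1)] by (rule monoid.m_closed[rotated])
    note ub = u[OF b(1)] u[OF b(2)] u[OF bb]
    note uc = ub(1,3,5)[THEN U_carrier]
    have "K 0 #>\<^bsub>F\<^esub> u (b \<otimes>\<^bsub>?B\<^esub> b') = K 0 #>\<^bsub>F\<^esub> (u b \<otimes>\<^bsub>F\<^esub> u b')"
      using ub uc by (intro u_cong) auto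
    then have "K c #>\<^bsub>F\<^esub> lcomm F (u (b \<otimes>\<^bsub>?B\<^esub> b')) (map r as)
        = K c #>\<^bsub>F\<^esub> lcomm F (u b \<otimes>\<^bsub>F\<^esub> u b') (map r as)"
      using lcomm_cong[OF W_cong_refl[OF rs[OF as(2)]] ub(5) U0.m_closed[OF ub(1,3)]] as(1) by simp
    also have "\<dots> = K c #>\<^bsub>F\<^esub> (lcomm F (u b) (map r as) \<otimes>\<^bsub>F\<^esub> lcomm F (u b') (map r as))"
      using lcomm_mult_left[OF ub(1,3) rs[OF as(2)]] as(1) by simp
    finally show "\<theta> (b \<otimes>\<^bsub>?B\<^esub> b', as) = \<theta> (b, as) \<otimes>\<^bsub>?M\<^esub> \<theta> (b', as)"
      unfolding \<theta>_def prod.case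
      using G.subquot_mult[OF LK lcomm_carrier[OF ub(1) rs] lcomm_carrier[OF ub(3) rs]] as(2) by simp
  next
    fix b as i a a'
    assume b: "b \<in> carrier ?B" and as: "length as = c" "set as \<subseteq> carrier ?A" and i: "i < c"
      and a: "a \<in> carrier ?A" "a' \<in> carrier ?A"
    have aa: "a \<otimes>\<^bsub>?A\<^esub> a' \<in> carrier ?A" using a by (rule A.m_closed)
    note ra = r[OF a(1)] r[OF a(2)] r[OF aa]
    have upd: "set (fs[i := f]) \<subseteq> CF" if "set fs \<subseteq> CF" "f \<in> CF" for fs f
      using that set_update_subset_insert[of fs i f] by auto
    have "Z #>\<^bsub>G\<^esub> \<pi> (r (a \<otimes>\<^bsub>?A\<^esub> a')) = Z #>\<^bsub>G\<^esub> \<pi> (r a \<otimes>\<^bsub>F\<^esub> r a')"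
      using ra by (simp add: flip: Z.rcos_sum)
    then have "W_cong (r (a \<otimes>\<^bsub>?A\<^esub> a')) (r a \<otimes>\<^bsub>F\<^esub> r a')" using ra by (intro r_cong) auto
    then have "list_all2 W_cong ((map r as)[i := r (a \<otimes>\<^bsub>?A\<^esub> a')]) ((map r as)[i := r a \<otimes>\<^bsub>F\<^esub> r a'])"
      using W_cong_refl[OF rs[OF as(2)]] by (intro list_all2_update_cong)
    then have "K c #>\<^bsub>F\<^esub> lcomm F (u b) ((map r as)[i := r (a \<otimes>\<^bsub>?A\<^esub> a')])
        = K c #>\<^bsub>F\<^esub> lcomm F (u b) ((map r as)[i := r a \<otimes>\<^bsub>F\<^esub> r a'])"
      using lcomm_cong[OF _ u(1)[OF b] u(1)[OF b] refl] as(1) by fastforce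
    also have "\<dots> = K c #>\<^bsub>F\<^esub> (lcomm F (u b) ((map r as)[i := r a]) \<otimes>\<^bsub>F\<^esub> lcomm F (u b) ((map r as)[i := r a']))"
      using lcomm_mult_nth[OF u(1)[OF b] rs[OF as(2)], of i "r a" "r a'"] as(1) i ra by simp
    finally show "\<theta> (b, as[i := a \<otimes>\<^bsub>?A\<^esub> a']) = \<theta> (b, as[i := a]) \<otimes>\<^bsub>?M\<^esub> \<theta> (b, as[i := a'])"
      unfolding \<theta>_def prod.case map_update
      using G.subquot_mult[OF LK lcomm_carrier[OF u(1)[OF b] upd[OF rs[OF as(2)] ra(1)]]
          lcomm_carrier[OF u(1)[OF b] upd[OF rs[OF as(2)] ra(3)]]] by simp
  qed
  interpret T: comm_group tensor by (rule comm_group_tensor_power[OF group_tensor_factors])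
  interpret h: group_hom tensor ?M h using h(1) by unfold_locales
  \<comment> \<open>Surjectivity amounts to \<open>U c \<subseteq> J\<close>, as \<open>L c\<close>
    and \<open>U c\<close> have the same cosets of \<open>K c\<close>. By
    \<open>gam_generated_by_lcomm\<close> it is enough to treat left-normed commutators and
    \<open>U (Suc c)\<close>.\<close>
  define J where "J = {y \<in> L c. K c #>\<^bsub>F\<^esub> y \<in> h ` carrier tensor}"
  interpret q: group_hom "F\<lparr>carrier := L c\<rparr>" ?M "\<lambda>x. K c #>\<^bsub>F\<^esub> x" by (rule G.subquot_proj[OF LK])
  interpret Lc: normal "L c" F by (rule L_normal)
  interpret I: subgroup "h ` carrier tensor" ?M by (rule h.img_is_subgroup)
  have "subgroup J F"
  proof
    show "J \<subseteq> CF" using Lc.subset by (auto simp: J_def)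
    show "\<one>\<^bsub>F\<^esub> \<in> J" using I.one_closed by (auto simp: J_def K.subset)
  next
    fix x y assume xy: "x \<in> J" "y \<in> J"
    then have "(K c #>\<^bsub>F\<^esub> x) \<otimes>\<^bsub>?M\<^esub> (K c #>\<^bsub>F\<^esub> y) \<in> h ` carrier tensor"
      unfolding J_def by (intro I.m_closed) auto
    then show "x \<otimes>\<^bsub>F\<^esub> y \<in> J" using xy q.hom_mult[of x y] by (simp add: J_def)
  next
    fix x assume x: "x \<in> J"
    then have "inv\<^bsub>?M\<^esub> (K c #>\<^bsub>F\<^esub> x) \<in> h ` carrier tensor"
      unfolding J_def by (intro I.m_inv_closed) auto
    moreover have "inv\<^bsub>F\<lparr>carrier := L c\<rparr>\<^esub> x = inv\<^bsub>F\<^esub> x"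
      using x G.m_inv_consistent[OF Lc.subgroup_axioms] by (simp add: J_def)
    ultimately show "inv\<^bsub>F\<^esub> x \<in> J" using x q.hom_inv[of x] by (simp add: J_def)
  qed
  moreover have "U (Suc c) \<subseteq> J"
  proof
    fix x assume "x \<in> U (Suc c)"
    then have x: "x \<in> K c" using U_Suc_subset_K by blast
    then have "K c #>\<^bsub>F\<^esub> x = \<one>\<^bsub>?M\<^esub>"
      using G.coset_join2[OF _ K.subgroup_axioms x] G.normal_mem_carrier[OF K_normal x] by simp
    then show "x \<in> J" using x K_subset_L I.one_closed by (auto simp: J_def)
  qed
  moreover have "lcomm F x fs \<in> J" if x: "x \<in> U 0" and fs: "length fs = c" "set fs \<subseteq> CF" for x fs
  proof -
    \<comment> \<open>The commutator \<open>lcomm F x fs\<close> is hit by the tensor of the images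
      of its own entries: the lifts chosen by \<open>u\<close> and \<open>r\<close> differ from
      \<open>x\<close> and \<open>fs\<close> only modulo \<open>R\<close> and
      \<open>W\<close>.\<close>
    let ?as = "map (\<lambda>f. Z #>\<^bsub>G\<^esub> \<pi> f) fs"
    have b: "\<pi> x \<in> carrier ?B" using x image_U0 by auto
    have as: "set ?as \<subseteq> carrier ?A" using fs by (auto simp: carrier_FactGroup)
    have "W_cong (r (Z #>\<^bsub>G\<^esub> \<pi> f)) f" if "f \<in> set fs" for f
    proof -
      have "f \<in> CF" "Z #>\<^bsub>G\<^esub> \<pi> f \<in> carrier ?A" using that fs as by auto
      then show ?thesis using r by (intro r_cong) simp_all
    qed
    then have "list_all2 W_cong (map r ?as) fs" by (simp add: list.rel_map list_all2_same)
    moreover have "K 0 #>\<^bsub>F\<^esub> u (\<pi> x) = K 0 #>\<^bsub>F\<^esub> x" using u[OF b] x U_carrier by (intro u_cong) auto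
    ultimately have "\<theta> (\<pi> x, ?as) = K c #>\<^bsub>F\<^esub> lcomm F x fs"
      using lcomm_cong[OF _ u(1)[OF b] x] fs(1) unfolding \<theta>_def by fastforce
    moreover have "(\<pi> x, ?as) \<in> tensor_gens ?B ?A c" using b as fs by (simp add: tensor_gens_def)
    ultimately have "K c #>\<^bsub>F\<^esub> lcomm F x fs \<in> h ` carrier tensor" using h(2) by (metis imageI subsetD)
    then show ?thesis using mem[OF x fs(2,1)] U_subset_L by (auto simp: J_def)
  qed
  ultimately have UJ: "U c \<subseteq> J"
    using G.gam_generated_by_lcomm[of J "t - 1" c] unfolding U_def by simp
  have "carrier ?M \<subseteq> h ` carrier tensor"
  proof
    fix y assume "y \<in> carrier ?M"
    then obtain s where s: "s \<in> L c" "y = K c #>\<^bsub>F\<^esub> s" unfolding G.subquot_carrier by blast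
    then obtain x where "x \<in> U c" "y = K c #>\<^bsub>F\<^esub> x" using L_coset by blast
    then show "y \<in> h ` carrier tensor" using UJ by (auto simp: J_def)
  qed
  then show thesis using that h.group_hom_axioms h.hom_closed by blast
qed

end

section \<open>The bounds for a relation subgroup and its enlargement\<close>

context nilpotent_ext
begin

text \<open>The map is induced by the identity of \<open>F\<close>. A coset \<open>K c #> x\<close>
  goes to \<open>L c #> x\<close>, so the kernel consists of the classes of \<open>L c\<close>, all
  of which lies in \<open>R \<inter> \<Gamma>\<close>.\<close>

lemma multiplier_restriction:
  obtains f where "group_hom (rel_multiplier c F R) (rel_multiplier c F S) f"
    "(rel_multiplier c F R)\<lparr>carrier := kernel (rel_multiplier c F R) (rel_multiplier c F S) f\<rparr>
      = F\<lparr>carrier := L c\<rparr> Mod K c"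
proof -
  interpret id: group_hom F F "\<lambda>x. x" by unfold_locales (auto simp: hom_def)
  have "(\<lambda>x. x) ` R \<subseteq> S" using R_subset_S by simp
  from rel_multiplier_map[OF id.group_hom_axioms R_normal S_normal this, of c]
  obtain f where f: "f \<in> hom (rel_multiplier c F R) (rel_multiplier c F S)"
    "\<And>x. x \<in> R \<inter> \<Gamma> \<Longrightarrow> x \<in> S \<inter> \<Gamma> \<and> f (K c #>\<^bsub>F\<^esub> x) = L c #>\<^bsub>F\<^esub> x"
    unfolding K_def L_def by blast
  have gh: "group_hom (rel_multiplier c F R) (rel_multiplier c F S) f"
    using f(1) G.comm_group_rel_multiplier[OF R_normal] G.comm_group_rel_multiplier[OF S_normal]
    by (simp add: group_hom_def group_hom_axioms_def comm_group_def)
  have car: "carrier (rel_multiplier c F R) = (\<lambda>x. K c #>\<^bsub>F\<^esub> x) ` (R \<inter> \<Gamma>)"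
    unfolding rel_multiplier_def G.subquot_carrier by (simp add: K_def)
  have L: "L c #>\<^bsub>F\<^esub> x = L c \<longleftrightarrow> x \<in> L c" if "x \<in> R \<inter> \<Gamma>" for x
  proof -
    have "x \<in> CF" using that by (simp add: R_def kernel_def)
    then show ?thesis
      using normal_imp_subgroup[OF L_normal] G.coset_join1 G.coset_join2 by metis
  qed
  have one: "\<one>\<^bsub>rel_multiplier c F S\<^esub> = L c" by (simp add: rel_multiplier_def L_def)
  have "kernel (rel_multiplier c F R) (rel_multiplier c F S) f = (\<lambda>x. K c #>\<^bsub>F\<^esub> x) ` L c"
  proof
    show "kernel (rel_multiplier c F R) (rel_multiplier c F S) f \<subseteq> (\<lambda>x. K c #>\<^bsub>F\<^esub> x) ` L c"
      using f(2) L unfolding kernel_def car one by auto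
    show "(\<lambda>x. K c #>\<^bsub>F\<^esub> x) ` L c \<subseteq> kernel (rel_multiplier c F R) (rel_multiplier c F S) f"
    proof
      fix y assume "y \<in> (\<lambda>x. K c #>\<^bsub>F\<^esub> x) ` L c"
      then obtain x where x: "x \<in> L c" "y = K c #>\<^bsub>F\<^esub> x" by blast
      then have "x \<in> R \<inter> \<Gamma>" using L_subset_R L_subset_\<Gamma> by blast
      then show "y \<in> kernel (rel_multiplier c F R) (rel_multiplier c F S) f"
        using f(2) L x unfolding kernel_def car one by auto
    qed
  qed
  then have "(rel_multiplier c F R)\<lparr>carrier := kernel (rel_multiplier c F R) (rel_multiplier c F S) f\<rparr>
      = F\<lparr>carrier := L c\<rparr> Mod K c"
    by (simp only: rel_multiplier_def K_def[symmetric] subquot_restrict)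
  then show thesis using that gh by blast
qed

lemma exponent_multiplier_dvd:
  "group_exponent (rel_multiplier c F R)
    dvd group_exponent (rel_multiplier c F S) * group_exponent tensor"
proof -
  obtain f where f: "group_hom (rel_multiplier c F R) (rel_multiplier c F S) f"
    "(rel_multiplier c F R)\<lparr>carrier := kernel (rel_multiplier c F R) (rel_multiplier c F S) f\<rparr>
      = F\<lparr>carrier := L c\<rparr> Mod K c" by (rule multiplier_restriction)
  obtain h where h: "group_hom tensor (F\<lparr>carrier := L c\<rparr> Mod K c) h"
    "h ` carrier tensor = carrier (F\<lparr>carrier := L c\<rparr> Mod K c)" by (rule tensor_onto_L)
  show ?thesis
    using h unfolding f(2)[symmetric] by (intro group_exponent_extension[OF f(1)]) auto
qed

text \<open>The image in the abelian group \<open>rel_multiplier c F S\<close> is a subgroup and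
  needs no more generators than the whole; the kernel is an image of the tensor power.\<close>

lemma gen_by_multiplier:
  assumes "gen_by (rel_multiplier c F S) m" "gen_by tensor n"
  shows "gen_by (rel_multiplier c F R) (m + n)"
proof -
  obtain f where f: "group_hom (rel_multiplier c F R) (rel_multiplier c F S) f"
    "(rel_multiplier c F R)\<lparr>carrier := kernel (rel_multiplier c F R) (rel_multiplier c F S) f\<rparr>
      = F\<lparr>carrier := L c\<rparr> Mod K c" by (rule multiplier_restriction)
  obtain h where h: "group_hom tensor (F\<lparr>carrier := L c\<rparr> Mod K c) h"
    "h ` carrier tensor = carrier (F\<lparr>carrier := L c\<rparr> Mod K c)" by (rule tensor_onto_L)
  interpret f: group_hom "rel_multiplier c F R" "rel_multiplier c F S" f by (rule f(1))
  show ?thesis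
  proof (rule gen_by_extension[OF f(1)])
    show "gen_by ((rel_multiplier c F S)\<lparr>carrier := f ` carrier (rel_multiplier c F R)\<rparr>) m"
      using G.comm_group_rel_multiplier[OF S_normal] f.img_is_subgroup assms(1)
      by (rule gen_by_subgroup)
    show "gen_by ((rel_multiplier c F R)\<lparr>carrier :=
        kernel (rel_multiplier c F R) (rel_multiplier c F S) f\<rparr>) n"
      unfolding f(2) using h assms(2) by (rule gen_by_hom)
  qed
qed

text \<open>The subgroups \<open>\<gamma>\<^sub>t(F)\<close> and \<open>\<Gamma>\<close> are nested,
  and the smaller one lies in \<open>S \<inter> \<Gamma>\<close>. The maximum treats both order
  statements at once.\<close>

lemma image_S_inter_\<Gamma>:
  "\<pi> ` (S \<inter> \<Gamma>) = lcs G (carrier G) (max t (c + 1))"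
proof (cases "c + 1 \<le> t")
  case True
  have "U 0 \<subseteq> \<Gamma>"
    using G.iter_comm_antimono[OF G.normal_carrier, of c "t - 1"] True by (simp add: U_def)
  then have "\<pi> ` U 0 \<subseteq> \<pi> ` (S \<inter> \<Gamma>)" using U_subset_L[of 0] by (auto simp: L_def)
  moreover have "\<pi> ` (S \<inter> \<Gamma>) \<subseteq> lcs G (carrier G) t" by (auto simp: S_def)
  ultimately show ?thesis using True image_U0 by (simp add: max_def)
next
  case False
  then have "\<Gamma> \<subseteq> U 0"
    using G.iter_comm_antimono[OF G.normal_carrier, of "t - 1" c] by (simp add: U_def)
  then have "S \<inter> \<Gamma> = \<Gamma>" using U_subset_L[of 0] by (auto simp: L_def)
  then show ?thesis using image_gam[of c] False by (simp add: max_def)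
qed

text \<open>The order of \<open>S \<inter> \<Gamma>\<close> modulo \<open>K c\<close> is computed
  along two chains, through \<open>R \<inter> \<Gamma>\<close> and through \<open>L c\<close>. The
  layer from \<open>K c\<close> to \<open>L c\<close> is an image of the tensor power, so its order
  divides that of \<open>tensor\<close>.\<close>

lemma order_multiplier_dvd:
  "order (G\<lparr>carrier := lcs G (carrier G) (max t (c + 1))\<rparr>) * order (rel_multiplier c F R)
    dvd order (rel_multiplier c F S) * order tensor"
proof -
  let ?B = "S \<inter> \<Gamma>" and ?A = "R \<inter> \<Gamma>"
  have A: "?A \<lhd> F" using R_normal G.lcs_normal by (rule G.normal_subgroup_intersect)
  have B: "subgroup ?B F"
    using S_normal G.lcs_normal by (intro normal_imp_subgroup G.normal_subgroup_intersect)
  have AB: "?A \<subseteq> ?B" using R_subset_S by blast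
  have LB: "L c \<subseteq> ?B" using L_subset_R R_subset_S L_subset_\<Gamma> by blast
  have KA: "K c \<subseteq> ?A" using K_subset_L L_subset_R L_subset_\<Gamma> by blast
  let ?H = "G\<lparr>carrier := lcs G (carrier G) (max t (c + 1))\<rparr>"
  have "group ?H" using H.subgroup_imp_group[OF normal_imp_subgroup[OF H.lcs_normal]] .
  moreover have "\<pi> \<in> hom (F\<lparr>carrier := ?B\<rparr>) ?H"
  proof (rule homI)
    show "\<pi> x \<in> carrier ?H" if "x \<in> carrier (F\<lparr>carrier := ?B\<rparr>)" for x
      using that image_S_inter_\<Gamma> by auto
    show "\<pi> (x \<otimes>\<^bsub>F\<lparr>carrier := ?B\<rparr>\<^esub> y) = \<pi> x \<otimes>\<^bsub>?H\<^esub> \<pi> y"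
      if "x \<in> carrier (F\<lparr>carrier := ?B\<rparr>)" "y \<in> carrier (F\<lparr>carrier := ?B\<rparr>)" for x y
      using that by (simp add: S_def)
  qed
  ultimately have \<pi>: "group_hom (F\<lparr>carrier := ?B\<rparr>) ?H \<pi>"
    using G.subgroup_imp_group[OF B] by (simp add: group_hom_def group_hom_axioms_def)
  have ker: "?A = kernel (F\<lparr>carrier := ?B\<rparr>) ?H \<pi>"
    by (auto simp: R_def S_def kernel_def
        intro: subgroup.one_closed[OF normal_imp_subgroup[OF H.lcs_normal]])
  have "order (F\<lparr>carrier := ?B\<rparr> Mod ?A) = order ?H"
    by (rule G.subquot_order_image[OF B \<pi> _ ker]) (use image_S_inter_\<Gamma> in simp)
  then have 1: "order (F\<lparr>carrier := ?B\<rparr> Mod K c) = order ?H * order (rel_multiplier c F R)"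
    using G.subquot_order_tower[OF K_normal A B KA AB] by (simp add: rel_multiplier_def K_def)
  have 2: "order (F\<lparr>carrier := ?B\<rparr> Mod K c)
      = order (rel_multiplier c F S) * order (F\<lparr>carrier := L c\<rparr> Mod K c)"
    using G.subquot_order_tower[OF K_normal L_normal B K_subset_L LB]
    by (simp add: rel_multiplier_def L_def)
  obtain h where h: "group_hom tensor (F\<lparr>carrier := L c\<rparr> Mod K c) h"
    "h ` carrier tensor = carrier (F\<lparr>carrier := L c\<rparr> Mod K c)" by (rule tensor_onto_L)
  have "order ?H * order (rel_multiplier c F R)
      = order (rel_multiplier c F S) * order (F\<lparr>carrier := L c\<rparr> Mod K c)"
    using 1 2 by (rule trans[OF sym])
  also have "\<dots> dvd order (rel_multiplier c F S) * order tensor"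
    using order_surj_hom[OF h] by (intro mult_dvd_mono dvd_refl dvdI)
  finally show ?thesis .
qed

end

text \<open>Induction on \<open>t\<close>, where
  \<open>iter_comm F (carrier F) (carrier F) t\<close> is
  \<open>\<gamma>\<^sub>t\<^sub>+\<^sub>1(F)\<close>. The step enlarges \<open>R\<close> to the
  preimage \<open>S\<close> of the last term of the lower central series of \<open>F Mod R\<close>
  and uses \<open>gen_by_multiplier\<close>.\<close>

lemma finitely_generated_multiplier:
  assumes "group F" "c \<ge> 1" "R \<lhd> F" "iter_comm F (carrier F) (carrier F) t \<subseteq> R"
    and "finite (carrier (F Mod R))"
  shows "\<exists>n. gen_by (rel_multiplier c F R) n"
  using assms(3-5)
proof (induction t arbitrary: R)
  case 0
  interpret F: group F by fact
  \<comment> \<open>Now \<open>[R,\<^sub>cF] = \<gamma>\<^sub>c\<^sub>+\<^sub>1(F)\<close>, so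
    numerator and denominator of the multiplier coincide.\<close>
  have R: "R = carrier F" using 0 F.normal_mem_carrier by auto
  let ?M = "rel_multiplier c F R"
  interpret M: comm_group ?M using 0(1) by (rule F.comm_group_rel_multiplier)
  note s = F.rel_multiplier_sub[OF 0(1), of c]
  have "carrier ?M \<subseteq> {\<one>\<^bsub>?M\<^esub>}"
  proof
    fix y assume "y \<in> carrier ?M"
    then obtain x where x: "x \<in> iter_comm F R (carrier F) c" "y = iter_comm F R (carrier F) c #>\<^bsub>F\<^esub> x"
      unfolding rel_multiplier_def F.subquot_carrier by (auto simp: R)
    then show "y \<in> {\<one>\<^bsub>?M\<^esub>}"
      using F.coset_join2[OF _ normal_imp_subgroup[OF s(1)]] F.normal_mem_carrier[OF s(1)]
      by (simp add: rel_multiplier_def)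
  qed
  then have "generate ?M {} = carrier ?M" using M.generate_empty by auto
  then show ?case unfolding gen_by_def by (intro exI[of _ 0] exI[of _ "{}"]) simp
next
  case (Suc t)
  interpret F: group F by fact
  let ?G = "F Mod R" and ?\<pi> = "\<lambda>x. R #>\<^bsub>F\<^esub> x"
  have R: "subgroup R F" using Suc.prems(1) by (rule normal_imp_subgroup)
  have gh: "group_hom F ?G ?\<pi>"
    using F.is_group normal.r_coset_hom_Mod[OF Suc.prems(1)] normal.factorgroup_is_group[OF Suc.prems(1)]
    by (simp add: group_hom_def group_hom_axioms_def)
  interpret gh: group_hom F ?G ?\<pi> by (rule gh)
  have surj: "?\<pi> ` carrier F = carrier ?G" by (simp add: carrier_FactGroup)
  have im: "?\<pi> ` iter_comm F (carrier F) (carrier F) k = iter_comm ?G (carrier ?G) (carrier ?G) k" for k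
    using image_iter_comm[OF gh subset_refl subset_refl] surj by simp
  have "?\<pi> x = R" if "x \<in> iter_comm F (carrier F) (carrier F) (Suc t)" for x
    using that Suc.prems(2) F.coset_join2[OF _ R] subgroup.mem_carrier[OF R] by blast
  then have "?\<pi> ` iter_comm F (carrier F) (carrier F) (Suc t) \<subseteq> {R}" by blast
  moreover have "\<one>\<^bsub>F\<^esub> \<in> iter_comm F (carrier F) (carrier F) (Suc t)"
    using subgroup.one_closed[OF normal_imp_subgroup[OF F.gam_normal]] .
  ultimately have nil: "lcs ?G (carrier ?G) (Suc t + 1) = {\<one>\<^bsub>?G\<^esub>}"
    using im[of "Suc t"] by auto
  interpret nilpotent_ext F ?G ?\<pi> c "Suc t"
    using surj assms(2) nil by unfold_locales simp_all
  \<comment> \<open>The locale takes the kernel of the projection as its relation subgroup; it is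
    the given \<open>R\<close>.\<close>
  have RR: "nilpotent_ext.R F ?G ?\<pi> = R"
  proof -
    have "?\<pi> x = R \<longleftrightarrow> x \<in> R" if "x \<in> carrier F" for x
      using that R F.coset_join1 F.coset_join2 by metis
    then show ?thesis using subgroup.subset[OF R] by (auto simp: R_def kernel_def)
  qed
  have "iter_comm F (carrier F) (carrier F) t \<subseteq> S"
    using U_subset_L[of 0] by (simp add: U_def L_def)
  moreover have "finite (carrier (F Mod S))"
  proof -
    \<comment> \<open>As \<open>order\<close> is 0 on infinite groups, the product formula passes
      finiteness on to \<open>F Mod S\<close>.\<close>
    have "order (F Mod R) = order (F Mod S) * order (F\<lparr>carrier := S\<rparr> Mod R)"
      using F.subquot_order_tower[OF Suc.prems(1) S_normal F.subgroup_self]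
        R_subset_S F.normal_mem_carrier[OF S_normal] by (simp add: RR subset_iff)
    moreover have "order (F Mod R) > 0"
      using Suc.prems(3) gh.H.order_gt_0_iff_finite by simp
    ultimately have "order (F Mod S) > 0" by simp
    then show ?thesis by (simp add: order_def card_gt_0_iff)
  qed
  ultimately obtain m where m: "gen_by (rel_multiplier c F S) m"
    using Suc.IH[OF S_normal] by blast
  have fin: "finite (lcs ?G (carrier ?G) (Suc t))"
    using finite_subset[OF _ Suc.prems(3)] gh.H.lcs_normal gh.H.normal_mem_carrier by blast
  have finA: "finite (carrier (?G Mod Z))"
    using Suc.prems(3) by (simp add: carrier_FactGroup)
  have "gen_by tensor (card (tensor_gens (?G\<lparr>carrier := lcs ?G (carrier ?G) (Suc t)\<rparr>) (?G Mod Z) c))"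
    using fin finA by (intro gen_by_tensor_power group_tensor_factors) auto
  then show ?case using gen_by_multiplier[OF m] unfolding RR by blast
qed

section \<open>The bounds for arbitrary free presentations\<close>

theorem theoremC:
  fixes G :: "('a, 'm) monoid_scheme"
    and Q :: "'x set" and \<pi> :: "('x \<times> bool) list \<Rightarrow> 'a"
    and Y :: "'y set" and \<rho> :: "('y \<times> bool) list \<Rightarrow> 'a set"
    and c t :: nat
  assumes "group G" and "finite (carrier G)"
    and "c \<ge> 1" and "t \<ge> 2" and "nilpotent_class G t"
    and "free_presentation Q \<pi> G"
    and "free_presentation Y \<rho> (G Mod lcs G (carrier G) t)"
  defines "M \<equiv> c_multiplier c Q \<pi> G"
    and "M' \<equiv> c_multiplier c Y \<rho> (G Mod lcs G (carrier G) t)"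
    and "T \<equiv> tensor_power c (G\<lparr>carrier := lcs G (carrier G) t\<rparr>)
                            (G Mod upper_central G (t - 1))"
  shows "(c + 1 \<le> t \<longrightarrow> order (G\<lparr>carrier := lcs G (carrier G) t\<rparr>) * order M dvd order M' * order T)
       \<and> (c + 1 > t \<longrightarrow> order (G\<lparr>carrier := lcs G (carrier G) (c + 1)\<rparr>) * order M dvd order M' * order T)
       \<and> group_exponent M dvd group_exponent M' * group_exponent T
       \<and> min_gens M \<le> min_gens M' + min_gens T"
proof -
  let ?F = "free_group Q" and ?N = "lcs G (carrier G) t"
  interpret F: group ?F by (rule group_free_group)
  interpret G: group G by fact
  have \<pi>: "\<pi> \<in> hom ?F G" "\<pi> ` carrier ?F = carrier G"
    using assms(6) by (auto simp: free_presentation_def)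
  interpret nilpotent_ext ?F G \<pi> c t
    using \<pi> assms(3-5) by unfold_locales (auto simp: nilpotent_class_def)
  \<comment> \<open>The multiplier of the quotient computed from the presentation of
    \<open>G\<close>. \<open>M'\<close> uses the unrelated presentation \<open>\<rho>\<close>, so
    each invariant has to be carried across an isomorphism.\<close>
  let ?M'' = "rel_multiplier c ?F S"
  have M: "M = rel_multiplier c ?F R" by (simp add: M_def c_multiplier_eq R_def)
  have T: "T = tensor" by (simp add: T_def Z_def)
  have "?M'' \<cong> M'"
    unfolding M'_def S_eq_kernel c_multiplier_eq[symmetric]
    using normal.factorgroup_is_group[OF G.lcs_normal] assms(7) quotient_hom
    by (rule c_multiplier_independent)
  then obtain h where h: "h \<in> iso ?M'' M'" by (auto simp: is_iso_def)
  have gM'': "group ?M''" using F.comm_group_rel_multiplier[OF S_normal] by (rule comm_group.axioms(2))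
  have "group_hom (free_group Y) (G Mod ?N) \<rho>"
    using assms(7) group_free_group normal.factorgroup_is_group[OF G.lcs_normal]
    by (simp add: free_presentation_def group_hom_def group_hom_axioms_def)
  then have gM': "group M'"
    unfolding M'_def c_multiplier_eq
    by (intro comm_group.axioms(2) group.comm_group_rel_multiplier group_free_group
        group_hom.normal_kernel)
  have hh: "group_hom ?M'' M' h" using h gM'' gM' by (simp add: group_hom_def group_hom_axioms_def iso_def)
  have bij: "bij_betw h (carrier ?M'') (carrier M')" using h by (simp add: iso_def)
  have order_eq: "order ?M'' = order M'" unfolding order_def using bij by (rule bij_betw_same_card)
  have exp_dvd: "group_exponent ?M'' dvd group_exponent M'"
    using group_exponent_inj[OF hh] bij by (simp add: bij_betw_def)
  have finS: "finite (carrier (?F Mod S))"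
  proof -
    interpret q: group_hom ?F "G Mod ?N" "\<lambda>x. ?N #>\<^bsub>G\<^esub> \<pi> x" by (rule quotient_hom(1))
    have "bij_betw (\<lambda>V. the_elem ((\<lambda>x. ?N #>\<^bsub>G\<^esub> \<pi> x) ` V)) (carrier (?F Mod S)) (carrier (G Mod ?N))"
      using q.FactGroup_iso_set[OF quotient_hom(2)] unfolding S_eq_kernel by (simp add: iso_def)
    moreover have "finite (carrier (G Mod ?N))" using assms(2) by (simp add: carrier_FactGroup)
    ultimately show ?thesis by (simp add: bij_betw_finite)
  qed
  have "iter_comm ?F (carrier ?F) (carrier ?F) (t - 1) \<subseteq> S"
    using U_subset_L[of 0] by (simp add: U_def L_def)
  \<comment> \<open>Finite generation moves from \<open>?M''\<close> to \<open>M'\<close>, where it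
    makes \<open>min_gens M'\<close> an attained value; the resulting generators are then pulled
    back through the inverse isomorphism.\<close>
  then obtain m where m: "gen_by ?M'' m"
    using finitely_generated_multiplier[OF F.is_group assms(3) S_normal _ finS] by blast
  have "gen_by M' m" using bij by (intro gen_by_hom[OF hh _ m]) (simp add: bij_betw_def)
  then have "gen_by M' (min_gens M')" by (rule gen_by_min_gens)
  have "group_hom M' ?M'' (inv_into (carrier ?M'') h)"
    using h gM'' gM' group.iso_set_sym[OF gM'' h] by (simp add: group_hom_def group_hom_axioms_def iso_def)
  moreover have "inv_into (carrier ?M'') h ` carrier M' = carrier ?M''"
    using bij_betw_inv_into[OF bij] by (simp add: bij_betw_def)
  ultimately have gen'': "gen_by ?M'' (min_gens M')" using \<open>gen_by M' (min_gens M')\<close> by (rule gen_by_hom)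
  have "finite ?N" using finite_subset[OF _ assms(2)] G.lcs_normal G.normal_mem_carrier by blast
  moreover have "finite (carrier (G Mod Z))" using assms(2) by (simp add: carrier_FactGroup)
  ultimately have "gen_by T (card (tensor_gens (G\<lparr>carrier := ?N\<rparr>) (G Mod Z) c))"
    unfolding T by (intro gen_by_tensor_power group_tensor_factors) auto
  then have "gen_by T (min_gens T)" by (rule gen_by_min_gens)
  then have "gen_by M (min_gens M' + min_gens T)"
    unfolding M T by (rule gen_by_multiplier[OF gen''])
  then have gens: "min_gens M \<le> min_gens M' + min_gens T" by (rule min_gens_le)
  have exp: "group_exponent M dvd group_exponent M' * group_exponent T"
    using exponent_multiplier_dvd mult_dvd_mono[OF exp_dvd dvd_refl] unfolding M T by (rule dvd_trans)
  have "order (G\<lparr>carrier := lcs G (carrier G) (max t (c + 1))\<rparr>) * order M dvd order M' * order T"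
    using order_multiplier_dvd unfolding M T order_eq .
  then show ?thesis using gens exp by (auto simp: max_def split: if_splits)
qed

end
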